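(* Let $\mathcal X\subseteq\mathbb R^d$ with $\|\mathcal X\|<\infty$, let $a>0$, let $h:\mathbb R\to\bar{\mathbb R}$, and for each $k\in\mathbb N$ let $\mathcal G_k$ be $\mathcal G_k^{\mathsf R}(a)$ (for all $k$) or $\mathcal G_k^{\mathsf S}(a)$ (for all $k$). Suppose that for every $k$, $h$ is differentiable on $\big[\underline C(\mathcal G_k,\mathcal X),\bar C(\mathcal G_k,\mathcal X)\big]$ with derivative $h'$, and that $\bar C(|h'\circ\mathcal G_k|,\mathcal X)\vee\bar C(|h\circ\mathcal G_k|,\mathcal X)\vee\bar C(|\mathcal G_k|,\mathcal X)$ is bounded, for all $k\in\mathbb N$, by a constant depending only on $a,h,\|\mathcal X\|$. Then there is a constant $C$ depending only on $h,a,\|\mathcal X\|$ such that for all $k,n\in\mathbb N$, $$\sup_{\mu,\nu\in\mathcal P(\mathcal X)}\mathbb E\Big[\big|\hat{\mathsf D}_{h,\mathcal G_k}(X^n,Y^n)-\mathsf D_{h,\mathcal G_k}(\mu,\nu)\big|\Big]\le C\,d^{3/2}n^{-1/2}.$$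
   Context: $\mathcal P(\mathcal X)$ is the set of Borel probability measures on $\mathcal X$; $\|\mathcal X\|:=\sup_{x\in\mathcal X}\|x\|_\infty$; $a\vee b=\max\{a,b\}$. Neural network class: for $k\in\mathbb N$, $a_1,a_2,a_3,a_4\ge 0$ and $\phi:\mathbb R\to\mathbb R$, $\mathcal G_k(a_1,a_2,a_3,a_4,\phi)$ is the set of functions $g:\mathbb R^d\to\mathbb R$ of the form $g(x)=\sum_{i=1}^k\beta_i\phi(w_i\cdot x+b_i)+w_0\cdot x+b_0$ with $\|w_i\|_1\le a_1$, $|b_i|\le a_1$, $|\beta_i|\le a_2$ for $1\le i\le k$, $|b_0|\le a_3$, $\|w_0\|_1\le a_4$. With $\phi_{\mathsf S}(z)=(1+e^{-z})^{-1}$ and $\phi_{\mathsf R}(z)=\max\{z,0\}$, set $\mathcal G_k^{\mathsf S}(a):=\mathcal G_k(k^{1/2}\log k,2k^{-1}a,a,0,\phi_{\mathsf S})$ and $\mathcal G_k^{\mathsf R}(a):=\mathcal G_k(1,2k^{-1}a,a,a,\phi_{\mathsf R})$. For a class $\mathcal F$ of functions on $\mathcal X$: $\underline C(\mathcal F,\mathcal X)=\inf_{x\in\mathcal X,f\in\mathcal F}f(x)$, $\bar C(\mathcal F,\mathcal X)=\sup_{x\in\mathcal X,f\in\mathcal F}f(x)$; $|\mathcal F|=\{|f|:f\in\mathcal F\}$, $|h\circ\mathcal F|=\{|h\circ f|:f\in\mathcal F\}$. $\mathsf D_{h,\mathcal G}(\mu,\nu)=\sup_{g\in\mathcal G}\mathbb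 E_\mu[g]-\mathbb E_\nu[h\circ g]$ and $\hat{\mathsf D}_{h,\mathcal G}(X^n,Y^n)=\sup_{g\in\mathcal G}\frac1n\sum_{i=1}^n[g(X_i)-h\circ g(Y_i)]$, where $X_1,\dots,X_n$ are i.i.d. from $\mu$ and $Y_1,\dots,Y_n$ are i.i.d. from $\nu$ (the two samples independent). *)

theory Defs
  imports "HOL-Probability.Probability"
begin

text \<open>
  The constant in the theorem must not depend on the dimension \<open>d\<close>, so \<open>d\<close> is a natural number and
  not a type: a vector of \<open>\<real>\<^sup>d\<close> is a function \<open>x :: nat \<Rightarrow> real\<close> that is extensional on \<open>{..<d}\<close>.
  The product sigma-algebra on \<open>\<real>\<^sup>d\<close> is its Borel sigma-algebra.
\<close>

type_synonym vector = "nat \<Rightarrow> real"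

definition Rd :: "nat \<Rightarrow> vector measure" where
  "Rd d = (\<Pi>\<^sub>M i\<in>{..<d}. (borel :: real measure))"

definition dot :: "nat \<Rightarrow> vector \<Rightarrow> vector \<Rightarrow> real" where
  "dot d w x = (\<Sum>j<d. w j * x j)"

definition norm_one :: "nat \<Rightarrow> vector \<Rightarrow> real" where
  "norm_one d w = (\<Sum>j<d. \<bar>w j\<bar>)"

definition set_norm :: "nat \<Rightarrow> vector set \<Rightarrow> ennreal" where
  "set_norm d X = (SUP x\<in>X. SUP i\<in>{..<d}. ennreal \<bar>x i\<bar>)"

text \<open>The Borel sigma-algebra of a subset \<open>X\<close>, which need not be measurable, is the trace on \<open>X\<close>.\<close>

definition borel_probs :: "nat \<Rightarrow> vector set \<Rightarrow> vector measure set" where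
  "borel_probs d X = {\<mu>. prob_space \<mu> \<and> sets \<mu> = sets (restrict_space (Rd d) X)}"

definition network_class ::
  "nat \<Rightarrow> nat \<Rightarrow> real \<Rightarrow> real \<Rightarrow> real \<Rightarrow> real \<Rightarrow> (real \<Rightarrow> real) \<Rightarrow> (vector \<Rightarrow> real) set" where
  "network_class d k a1 a2 a3 a4 \<phi> =
    {g. \<exists>(\<beta> :: nat \<Rightarrow> real) (w :: nat \<Rightarrow> vector) (b :: nat \<Rightarrow> real).
        g = (\<lambda>x. (\<Sum>i=1..k. \<beta> i * \<phi> (dot d (w i) x + b i)) + dot d (w 0) x + b 0) \<and>
        (\<forall>i\<in>{1..k}. norm_one d (w i) \<le> a1 \<and> \<bar>b i\<bar> \<le> a1 \<and> \<bar>\<beta> i\<bar> \<le> a2) \<and>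
        \<bar>b 0\<bar> \<le> a3 \<and> norm_one d (w 0) \<le> a4}"

definition sigmoid :: "real \<Rightarrow> real" where
  "sigmoid z = 1 / (1 + exp (- z))"

definition relu :: "real \<Rightarrow> real" where
  "relu z = max z 0"

definition sigmoid_class :: "nat \<Rightarrow> nat \<Rightarrow> real \<Rightarrow> (vector \<Rightarrow> real) set" where
  "sigmoid_class d k a =
    network_class d k (sqrt (real k) * ln (real k)) (2 * a / real k) a 0 sigmoid"

definition relu_class :: "nat \<Rightarrow> nat \<Rightarrow> real \<Rightarrow> (vector \<Rightarrow> real) set" where
  "relu_class d k a = network_class d k 1 (2 * a / real k) a a relu"

definition lower_C :: "('a \<Rightarrow> ereal) set \<Rightarrow> 'a set \<Rightarrow> ereal" where
  "lower_C F X = (INF f\<in>F. INF x\<in>X. f x)"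

definition upper_C :: "('a \<Rightarrow> ereal) set \<Rightarrow> 'a set \<Rightarrow> ereal" where
  "upper_C F X = (SUP f\<in>F. SUP x\<in>X. f x)"

definition comp_class :: "(real \<Rightarrow> ereal) \<Rightarrow> ('a \<Rightarrow> real) set \<Rightarrow> ('a \<Rightarrow> ereal) set" where
  "comp_class f G = (\<lambda>g x. f (g x)) ` G"

definition abs_funs :: "('a \<Rightarrow> ereal) set \<Rightarrow> ('a \<Rightarrow> ereal) set" where
  "abs_funs F = (\<lambda>f x. \<bar>f x\<bar>) ` F"

definition range_interval :: "('a \<Rightarrow> real) set \<Rightarrow> 'a set \<Rightarrow> real set" where
  "range_interval G X =
    {t. lower_C (comp_class ereal G) X \<le> ereal t \<and> ereal t \<le> upper_C (comp_class ereal G) X}"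

text \<open>
  Differentiability of an extended-real function on \<open>I\<close> includes finiteness on \<open>I\<close>; at an endpoint
  of an interval only the one-sided derivative is required.
\<close>

definition has_derivative_fun_on ::
  "(real \<Rightarrow> ereal) \<Rightarrow> (real \<Rightarrow> real) \<Rightarrow> real set \<Rightarrow> bool" where
  "has_derivative_fun_on h h' I \<longleftrightarrow>
    (\<forall>t\<in>I. \<bar>h t\<bar> \<noteq> \<infinity> \<and>
      ((\<lambda>s. real_of_ereal (h s)) has_real_derivative h' t) (at t within I))"

text \<open>Expectation of an extended-real function: positive part minus negative part
  (\<^const>\<open>e2ennreal\<close> sends negative values to \<open>0\<close>).\<close>

definition ext_expectation :: "'a measure \<Rightarrow> ('a \<Rightarrow> ereal) \<Rightarrow> ereal" where
  "ext_expectation M f =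
    enn2ereal (\<integral>\<^sup>+x. e2ennreal (f x) \<partial>M) - enn2ereal (\<integral>\<^sup>+x. e2ennreal (- f x) \<partial>M)"

definition D_dist ::
  "(real \<Rightarrow> ereal) \<Rightarrow> ('a \<Rightarrow> real) set \<Rightarrow> 'a measure \<Rightarrow> 'a measure \<Rightarrow> ereal" where
  "D_dist h G \<mu> \<nu> =
    (SUP g\<in>G. ext_expectation \<mu> (\<lambda>x. ereal (g x)) - ext_expectation \<nu> (\<lambda>y. h (g y)))"

definition D_emp ::
  "(real \<Rightarrow> ereal) \<Rightarrow> ('a \<Rightarrow> real) set \<Rightarrow> nat \<Rightarrow> (nat \<Rightarrow> 'a) \<Rightarrow> (nat \<Rightarrow> 'a) \<Rightarrow> ereal" where
  "D_emp h G n xs ys =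
    (SUP g\<in>G. ereal (1 / real n) * (\<Sum>i<n. ereal (g (xs i)) - h (g (ys i))))"

text \<open>Joint law of \<open>n\<close> i.i.d. samples from \<open>\<mu>\<close> and, independently, \<open>n\<close> i.i.d. samples from \<open>\<nu>\<close>.\<close>

definition sample_law ::
  "nat \<Rightarrow> 'a measure \<Rightarrow> 'a measure \<Rightarrow> ((nat \<Rightarrow> 'a) \<times> (nat \<Rightarrow> 'a)) measure" where
  "sample_law n \<mu> \<nu> = (\<Pi>\<^sub>M i\<in>{..<n}. \<mu>) \<Otimes>\<^sub>M (\<Pi>\<^sub>M i\<in>{..<n}. \<nu>)"

definition expected_error ::
  "(real \<Rightarrow> ereal) \<Rightarrow> ('a \<Rightarrow> real) set \<Rightarrow> nat \<Rightarrow> 'a measure \<Rightarrow> 'a measure \<Rightarrow> ennreal" where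
  "expected_error h G n \<mu> \<nu> =
    (\<integral>\<^sup>+\<omega>. e2ennreal \<bar>D_emp h G n (fst \<omega>) (snd \<omega>) - D_dist h G \<mu> \<nu>\<bar> \<partial>sample_law n \<mu> \<nu>)"

end

theory Submission
  imports Defs
begin

text \<open>
  The difference of the two suprema is at most the supremum, over the class, of the deviation of
  the empirical means of \<open>g\<close> under \<open>\<mu>\<close> plus that of \<open>h \<circ> g\<close> under \<open>\<nu>\<close>. Both are empirical
  processes, and the task is to bound their expected suprema by \<open>C d\<^bsup>3/2\<^esup> n\<^bsup>-1/2\<^esup>\<close>, with neither a
  logarithm of \<open>n\<close> nor any dependence on the width \<open>k\<close>.

  Integrating out one sample point at a time replaces its centred contribution by a random sign and,
  in the same step, replaces \<open>h \<circ> g\<close> by a Lipschitz constant times \<open>g\<close> (\<open>symmetrize_one_coordinate\<close>,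
  \<open>symmetrize_sample\<close>). This is available for \<open>h\<close> because the values of the class form an interval
  (the class is star-shaped about \<open>0\<close>), on which the bound on \<open>h'\<close> makes \<open>h\<close> Lipschitz. What remains
  is the Rademacher average of the class on fixed points \<open>x\<^sub>0, \<dots>, x\<^sub>n\<^sub>-\<^sub>1\<close>.

  The inner weights of the sigmoid networks grow with \<open>k\<close>, so comparing a network with its linear
  parts loses a factor of order \<open>\<surd>k log k\<close>. Instead only monotonicity of the activation is used: a
  monotone function of \<open>w \<bullet> x\<close> with values in \<open>[0, B]\<close> is \<open>B\<close> times an average of indicators of
  half-spaces (\<open>monotone_ridge_bound\<close>). Hence \<open>|\<Sum> \<sigma>\<^sub>i g(x\<^sub>i)|\<close> is, for every choice of signs, at most
  \<open>a (5M + 3)\<close> times the supremum of \<open>|\<Sum> \<sigma>\<^sub>i 1\<^sub>A(x\<^sub>i)|\<close> over half-spaces \<open>A\<close>, where \<open>M\<close> bounds the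
  coordinates (\<open>relu_class_bound\<close>, \<open>sigmoid_class_bound\<close>).

  Half-spaces cut out at most \<open>(N + 1)\<^bsup>d+1\<^esup>\<close> subsets of \<open>N\<close> points (\<open>card_sign_patterns_le\<close>). A
  family with such polynomial growth has small packings in the Hamming distance
  (\<open>packing_bound\<close>), and chaining along nets at scales \<open>n 16\<^sup>-\<^sup>j\<close> turns this into an average of at most
  \<open>174 (d + 1) \<surd>n\<close> (\<open>rademacher_mean_sets_le\<close>). Chaining is what avoids the factor \<open>\<surd>log n\<close>; the
  exponent of \<open>d\<close> obtained is \<open>1\<close>.

  The suprema run over uncountable classes. Networks depend continuously on their parameters, so a
  countable subclass is pointwise dense, and monotone convergence reduces everything to finite
  classes.
\<close>

section \<open>Random signs and finite classes\<close>

text \<open>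
  The expectation of \<open>\<Phi> \<sigma>\<close> when \<open>\<sigma> 0, \<dots>, \<sigma> (n - 1)\<close> are independent fair signs. Averaging over the
  last sign first matches the arguments below, which treat one sign or one sample point at a time.
  The coordinates from \<open>n\<close> on carry the dummy value \<open>1\<close>.
\<close>

fun rademacher_mean :: "nat \<Rightarrow> ((nat \<Rightarrow> real) \<Rightarrow> real) \<Rightarrow> real" where
  "rademacher_mean 0 \<Phi> = \<Phi> (\<lambda>_. 1)"
| "rademacher_mean (Suc n) \<Phi> =
    (rademacher_mean n (\<lambda>\<sigma>. \<Phi> (\<sigma>(n := 1))) + rademacher_mean n (\<lambda>\<sigma>. \<Phi> (\<sigma>(n := -1)))) / 2"

lemma rademacher_mean_mono:
  assumes "\<And>\<sigma>. \<Phi> \<sigma> \<le> \<Psi> \<sigma>"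
  shows "rademacher_mean n \<Phi> \<le> rademacher_mean n \<Psi>"
  using assms
proof (induction n arbitrary: \<Phi> \<Psi>)
  case (Suc n)
  have "rademacher_mean n (\<lambda>\<sigma>. \<Phi> (\<sigma>(n := e))) \<le> rademacher_mean n (\<lambda>\<sigma>. \<Psi> (\<sigma>(n := e)))" for e
    by (rule Suc.IH) (rule Suc.prems)
  from this[of 1] this[of "-1"] show ?case by simp
qed simp

lemma rademacher_mean_add:
  "rademacher_mean n (\<lambda>\<sigma>. \<Phi> \<sigma> + \<Psi> \<sigma>) = rademacher_mean n \<Phi> + rademacher_mean n \<Psi>"
  by (induction n arbitrary: \<Phi> \<Psi>) (simp_all add: field_simps)

lemma rademacher_mean_cmult:
  "rademacher_mean n (\<lambda>\<sigma>. c * \<Phi> \<sigma>) = c * rademacher_mean n \<Phi>"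
  by (induction n arbitrary: \<Phi>) (simp_all add: field_simps)

lemma rademacher_mean_const: "rademacher_mean n (\<lambda>\<sigma>. c) = c"
  by (induction n) simp_all

lemma rademacher_mean_sum:
  "rademacher_mean n (\<lambda>\<sigma>. \<Sum>i\<in>I. \<Phi> i \<sigma>) = (\<Sum>i\<in>I. rademacher_mean n (\<Phi> i))"
  by (induction I rule: infinite_finite_induct)
    (simp_all add: rademacher_mean_const rademacher_mean_add)

lemma cosh_le_exp_half_square: "cosh x \<le> exp (x\<^sup>2 / 2)" for x :: real
proof -
  have c: "(\<lambda>k. x ^ (2*k) / fact (2*k)) sums cosh x"
  proof -
    have "(\<lambda>k. (if even (2*k) then x ^ (2*k) /\<^sub>R fact (2*k) else 0)) sums cosh x"
      by (rule sums_mono_reindex[THEN iffD2, OF _ _ cosh_converges])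
        (auto simp: strict_mono_def elim!: evenE)
    then show ?thesis by (simp add: divide_inverse_commute)
  qed
  have e: "(\<lambda>k. (x\<^sup>2 / 2) ^ k / fact k) sums exp (x\<^sup>2 / 2)"
    using exp_converges[of "x\<^sup>2 / 2"] by (simp only: real_scaleR_def divide_inverse_commute)
  \<comment> \<open>Compare the power series termwise: \<open>(2k)! \<ge> 2\<^sup>k k!\<close>.\<close>
  have f: "(2::real) ^ k * fact k \<le> fact (2*k)" for k
  proof (induction k)
    case (Suc k)
    have "(2::real) ^ Suc k * fact (Suc k) = (2 * (real k + 1)) * (2 ^ k * fact k)" by simp
    also have "\<dots> \<le> (2 * (real k + 1)) * fact (2*k)"
      by (intro mult_left_mono Suc.IH) simp
    also have "\<dots> \<le> (2 * real k + 2) * (2 * real k + 1) * fact (2*k)"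
      by (intro mult_right_mono) (auto simp: field_simps)
    also have "\<dots> = fact (2 * Suc k)" by (simp add: algebra_simps)
    finally show ?case .
  qed simp
  have "x ^ (2*k) / fact (2*k) \<le> (x\<^sup>2 / 2) ^ k / fact k" for k
  proof -
    have "x ^ (2*k) / fact (2*k) \<le> x ^ (2*k) / (2 ^ k * fact k)"
      using f by (intro divide_left_mono) auto
    then show ?thesis by (simp add: power_mult power_divide)
  qed
  then show ?thesis by (rule sums_le[OF _ c e])
qed

text \<open>
  Rademacher sums are sub-Gaussian: by independence the moment generating function is a product of
  hyperbolic cosines.
\<close>

lemma rademacher_mean_exp_le:
  "rademacher_mean n (\<lambda>\<sigma>. exp (l * (\<Sum>i<n. \<sigma> i * u i))) \<le> exp (l\<^sup>2 * (\<Sum>i<n. (u i)\<^sup>2) / 2)"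
proof (induction n)
  case (Suc n)
  let ?E = "\<lambda>\<sigma>. exp (l * (\<Sum>i<n. \<sigma> i * u i))"
  have *: "rademacher_mean n (\<lambda>\<sigma>. exp (l * (\<Sum>i<Suc n. (\<sigma>(n := e)) i * u i)))
      = exp (e * (l * u n)) * rademacher_mean n ?E" for e
  proof -
    have "(\<lambda>\<sigma>::nat\<Rightarrow>real. exp (l * (\<Sum>i<Suc n. (\<sigma>(n := e)) i * u i)))
        = (\<lambda>\<sigma>. exp (e * (l * u n)) * ?E \<sigma>)"
      by (simp add: fun_eq_iff exp_add[symmetric] algebra_simps)
    then show ?thesis by (simp only: rademacher_mean_cmult)
  qed
  have "rademacher_mean (Suc n) (\<lambda>\<sigma>. exp (l * (\<Sum>i<Suc n. \<sigma> i * u i)))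
      = cosh (l * u n) * rademacher_mean n ?E"
    by (simp only: rademacher_mean.simps * cosh_def) (simp add: algebra_simps)
  also have "\<dots> \<le> exp ((l * u n)\<^sup>2 / 2) * exp (l\<^sup>2 * (\<Sum>i<n. (u i)\<^sup>2) / 2)"
    by (intro mult_mono Suc.IH cosh_le_exp_half_square)
      (auto intro: order_trans[OF _ rademacher_mean_mono[of "\<lambda>_. 0"]] simp: rademacher_mean_const)
  also have "\<dots> = exp (l\<^sup>2 * (\<Sum>i<Suc n. (u i)\<^sup>2) / 2)"
    by (simp add: exp_add[symmetric] field_simps)
  finally show ?case .
qed simp

text \<open>
  Massart's maximal inequality. The scale \<open>l\<close> is left free: the optimal choice is
  \<open>\<surd>(2 ln (2 |I|) / s)\<close>, but with a suboptimal one no square root of a logarithm has to be handled.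
\<close>

lemma massart_finite_class:
  assumes fin: "finite I" "I \<noteq> {}" and l: "l > 0"
    and s: "\<And>t. t \<in> I \<Longrightarrow> (\<Sum>i<n. (u t i)\<^sup>2) \<le> s"
  shows "rademacher_mean n (\<lambda>\<sigma>. Max ((\<lambda>t. \<bar>\<Sum>i<n. \<sigma> i * u t i\<bar>) ` I))
    \<le> ln (2 * card I) / l + l * s / 2"
proof -
  let ?Y = "\<lambda>\<sigma> t. \<Sum>i<n. \<sigma> i * u t i"
  define A where "A = 2 * real (card I) * exp (l\<^sup>2 * s / 2)"
  have N: "real (card I) > 0" using fin by (simp add: card_gt_0_iff)
  then have A: "A > 0" by (simp add: A_def)
  have lnA: "ln A = ln (2 * card I) + l\<^sup>2 * s / 2"
    using N by (simp add: A_def ln_mult)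
  \<comment> \<open>The tangent line \<open>y \<le> ln A - 1 + e\<^sup>y / A\<close> of the logarithm replaces an appeal to Jensen; the value of \<open>A\<close> is an upper bound for the mean of the sum of exponentials, where the tangent is tight.\<close>
  let ?\<Psi> = "\<lambda>\<sigma>. (ln A - 1) / l + (1 / (l * A)) *
      (\<Sum>t\<in>I. exp (l * ?Y \<sigma> t) + exp ((-l) * ?Y \<sigma> t))"
  have "Max ((\<lambda>t. \<bar>?Y \<sigma> t\<bar>) ` I) \<le> ?\<Psi> \<sigma>" for \<sigma>
  proof -
    have "\<bar>?Y \<sigma> t\<bar> \<le> ?\<Psi> \<sigma>" if t: "t \<in> I" for t
    proof -
      let ?y = "\<bar>?Y \<sigma> t\<bar>"
      have "1 + (l * ?y - ln A) \<le> exp (l * ?y - ln A)" by (rule exp_ge_add_one_self)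
      also have "\<dots> = exp (l * ?y) / A" using A by (simp add: exp_diff)
      also have "exp (l * ?y) \<le> exp (l * ?Y \<sigma> t) + exp ((-l) * ?Y \<sigma> t)"
        by (cases "?Y \<sigma> t \<ge> 0") (simp_all add: abs_if)
      also have "\<dots> \<le> (\<Sum>t\<in>I. exp (l * ?Y \<sigma> t) + exp ((-l) * ?Y \<sigma> t))"
        by (rule member_le_sum[OF t]) (use fin in \<open>auto intro: add_nonneg_nonneg\<close>)
      finally have "l * ?y \<le> ln A - 1 + (\<Sum>t\<in>I. exp (l * ?Y \<sigma> t) + exp ((-l) * ?Y \<sigma> t)) / A"
        using A by (simp add: divide_right_mono)
      then have "?y \<le> (ln A - 1 + (\<Sum>t\<in>I. exp (l * ?Y \<sigma> t) + exp ((-l) * ?Y \<sigma> t)) / A) / l"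
        using l by (simp add: pos_le_divide_eq mult.commute)
      then show ?thesis by (simp add: add_divide_distrib mult.commute)
    qed
    then show ?thesis using fin by (intro Max.boundedI) auto
  qed
  then have "rademacher_mean n (\<lambda>\<sigma>. Max ((\<lambda>t. \<bar>?Y \<sigma> t\<bar>) ` I)) \<le> rademacher_mean n ?\<Psi>"
    by (rule rademacher_mean_mono)
  also have "\<dots> = (ln A - 1) / l + (1 / (l * A)) *
      (\<Sum>t\<in>I. rademacher_mean n (\<lambda>\<sigma>. exp (l * ?Y \<sigma> t))
           + rademacher_mean n (\<lambda>\<sigma>. exp ((-l) * ?Y \<sigma> t)))"
    by (simp only: rademacher_mean_add rademacher_mean_cmult rademacher_mean_const
        rademacher_mean_sum)
  also have "\<dots> \<le> (ln A - 1) / l + (1 / (l * A)) *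
      (\<Sum>t\<in>I. exp (l\<^sup>2 * s / 2) + exp (l\<^sup>2 * s / 2))"
  proof -
    have "rademacher_mean n (\<lambda>\<sigma>. exp (m * ?Y \<sigma> t)) \<le> exp (l\<^sup>2 * s / 2)"
      if "t \<in> I" "m\<^sup>2 = l\<^sup>2" for m t
    proof -
      have "rademacher_mean n (\<lambda>\<sigma>. exp (m * ?Y \<sigma> t)) \<le> exp (m\<^sup>2 * (\<Sum>i<n. (u t i)\<^sup>2) / 2)"
        by (rule rademacher_mean_exp_le)
      also have "\<dots> \<le> exp (l\<^sup>2 * s / 2)"
        using s[OF that(1)] by (simp add: that(2) mult_left_mono)
      finally show ?thesis .
    qed
    from this[where m = l] this[where m = "-l"] show ?thesis
      using l A by (intro add_left_mono mult_left_mono sum_mono add_mono) auto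
  qed
  also have "\<dots> = ln A / l"
    using A l N by (simp add: A_def field_simps)
  also have "\<dots> = ln (2 * card I) / l + l * s / 2"
    using l by (simp add: lnA field_simps power2_eq_square)
  finally show ?thesis .
qed

section \<open>Families of sets with polynomial growth\<close>

text \<open>
  A linear space of functions of dimension \<open>m\<close> has at most \<open>(N + 1)\<^sup>m\<close> sets of positivity on \<open>N\<close> points,
  by Cover's count. Adding a point \<open>p\<close> at most doubles each pattern, and a pattern doubles only if it is
  realised both by a function positive at \<open>p\<close> and by one nonpositive at \<open>p\<close>; a positive combination of
  the two vanishes at \<open>p\<close> and still realises it. So the doubled patterns come from a space of
  dimension \<open>m - 1\<close>. The span is given by generators \<open>e j\<close>, and elimination produces those of the
  subspace.
\<close>

lemma card_sign_patterns_le: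
  fixes e :: "'b \<Rightarrow> 'a \<Rightarrow> real"
  assumes "finite S" "finite J"
  shows "card (range (\<lambda>c. {i\<in>S. 0 < (\<Sum>j\<in>J. c j * e j i)})) \<le> (card S + 1) ^ card J"
  using assms
proof (induction S arbitrary: J e rule: finite_induct)
  case empty
  show ?case by simp
next
  case (insert p S)
  define f where "f = (\<lambda>c i. \<Sum>j\<in>J. c j * e j i)"
  define pat where "pat = (\<lambda>S. range (\<lambda>c. {i\<in>S. 0 < f c i}))"
  define P1 where "P1 = {A \<in> pat (insert p S). p \<notin> A}"
  define P2 where "P2 = (\<lambda>A. A - {p}) ` {A \<in> pat (insert p S). p \<in> A}"
  have sub: "pat S' \<subseteq> Pow S'" for S' by (auto simp: pat_def)
  have fin: "finite (pat S)" "finite (pat (insert p S))"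
    using insert.hyps by (auto intro: finite_subset[OF sub])
  have "pat (insert p S) = P1 \<union> {A \<in> pat (insert p S). p \<in> A}" by (auto simp: P1_def)
  then have "card (pat (insert p S)) = card P1 + card {A \<in> pat (insert p S). p \<in> A}"
    using fin by (subst card_Un_disjoint[symmetric]) (auto simp: P1_def)
  also have "card {A \<in> pat (insert p S). p \<in> A} = card P2"
    unfolding P2_def by (rule card_image[symmetric]) (auto simp: inj_on_def)
  finally have c1: "card (pat (insert p S)) = card P1 + card P2" .
  have P1f: "\<exists>c. A = {i\<in>S. 0 < f c i} \<and> f c p \<le> 0" if "A \<in> P1" for A
  proof -
    from that obtain c where "A = {i\<in>insert p S. 0 < f c i}" "p \<notin> A"
      by (auto simp: P1_def pat_def)
    then show ?thesis by (intro exI[of _ c]) auto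
  qed
  have P2f: "\<exists>c. A = {i\<in>S. 0 < f c i} \<and> 0 < f c p" if "A \<in> P2" for A
  proof -
    from that obtain c where "A = {i\<in>insert p S. 0 < f c i} - {p}" "p \<in> {i\<in>insert p S. 0 < f c i}"
      by (auto simp: P2_def pat_def)
    then show ?thesis using insert.hyps by (intro exI[of _ c]) auto
  qed
  have sub12: "P1 \<subseteq> pat S" "P2 \<subseteq> pat S"
    using P1f P2f unfolding pat_def by blast+
  have fin12: "finite P1" "finite P2" using sub12 fin(1) finite_subset by auto
  have IH: "card (pat S) \<le> (card S + 1) ^ card J"
    unfolding pat_def f_def by (rule insert.IH[OF insert.prems])
  have c2: "card P1 + card P2 \<le> card (pat S) + card (P1 \<inter> P2)"
    unfolding card_Un_Int[OF fin12] using sub12 fin by (intro add_right_mono card_mono) auto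
  show ?case
  proof (cases "P1 \<inter> P2 = {}")
    case True
    then have "card (pat (insert p S)) \<le> (card S + 1) ^ card J" using c1 c2 IH by simp
    also have "\<dots> \<le> (card (insert p S) + 1) ^ card J"
      using insert.hyps by (intro power_mono) auto
    finally show ?thesis by (simp add: pat_def f_def)
  next
    case False
    then obtain c0 where "0 < f c0 p" using P2f by blast
    then obtain j0 where j0: "j0 \<in> J" "e j0 p \<noteq> 0"
      by (metis (mono_tags, lifting) f_def mult_zero_right sum.neutral order_less_irrefl)
    define J' where "J' = J - {j0}"
    \<comment> \<open>Gaussian elimination at \<open>p\<close> with pivot \<open>j0\<close>: every \<open>e\<^sub>j'\<close> vanishes at \<open>p\<close>.\<close>
    define e' where "e' = (\<lambda>j i. e j i - e j p / e j0 p * e j0 i)"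
    have J: "J = insert j0 J'" "j0 \<notin> J'" "finite J'" using j0 insert.prems by (auto simp: J'_def)
    have "P1 \<inter> P2 \<subseteq> range (\<lambda>c. {i\<in>S. 0 < (\<Sum>j\<in>J'. c j * e' j i)})"
    proof
      fix A assume "A \<in> P1 \<inter> P2"
      then obtain c1 c2 where c1: "A = {i\<in>S. 0 < f c1 i}" "f c1 p \<le> 0"
        and c2: "A = {i\<in>S. 0 < f c2 i}" "0 < f c2 p" using P1f P2f by blast
      \<comment> \<open>The coefficient of \<open>c1\<close> is positive and that of \<open>c2\<close> nonnegative, so strict positivity survives even if \<open>f c1 p = 0\<close>.\<close>
      define c where "c = (\<lambda>j. f c2 p * c1 j + (- f c1 p) * c2 j)"
      have fc: "f c i = f c2 p * f c1 i + (- f c1 p) * f c2 i" for i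
      proof -
        have "f c i = (\<Sum>j\<in>J. f c2 p * (c1 j * e j i) + (- f c1 p) * (c2 j * e j i))"
          unfolding f_def c_def by (intro sum.cong) (auto simp: algebra_simps)
        also have "\<dots> = f c2 p * (\<Sum>j\<in>J. c1 j * e j i) + (- f c1 p) * (\<Sum>j\<in>J. c2 j * e j i)"
          unfolding sum.distrib sum_distrib_left ..
        also have "\<dots> = f c2 p * f c1 i + (- f c1 p) * f c2 i" by (simp add: f_def)
        finally show ?thesis .
      qed
      have A: "A = {i\<in>S. 0 < f c i}"
      proof -
        have "0 < f c i \<longleftrightarrow> i \<in> A" if i: "i \<in> S" for i
        proof (cases "i \<in> A")
          case True
          then have "0 < f c1 i" "0 < f c2 i" using c1 c2 by auto
          then have "0 < f c2 p * f c1 i" "0 \<le> (- f c1 p) * f c2 i"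
            using c1(2) c2(2) by (auto intro: mult_nonpos_nonneg)
          then show ?thesis using True fc by simp
        next
          case False
          then have "f c1 i \<le> 0" "f c2 i \<le> 0" using c1(1) c2(1) i by fastforce+
          then have "f c2 p * f c1 i \<le> 0" "(- f c1 p) * f c2 i \<le> 0"
            using c1(2) c2(2) by (auto simp: mult_le_0_iff intro: mult_nonpos_nonpos)
          then show ?thesis using False fc[of i] by linarith
        qed
        moreover have "A \<subseteq> S" using c1 by auto
        ultimately show ?thesis by blast
      qed
      have "f c p = 0" by (simp add: fc)
      then have "c j0 * e j0 p = - (\<Sum>j\<in>J'. c j * e j p)"
        using J by (simp add: f_def)
      then have cj0: "c j0 = - (\<Sum>j\<in>J'. c j * e j p) / e j0 p"
        using j0 by (simp add: field_simps)
      have "f c i = (\<Sum>j\<in>J'. c j * e' j i)" for i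
      proof -
        have "f c i = c j0 * e j0 i + (\<Sum>j\<in>J'. c j * e j i)" using J by (simp add: f_def)
        also have "\<dots> = (\<Sum>j\<in>J'. c j * e j i) - (\<Sum>j\<in>J'. c j * e j p) * (e j0 i / e j0 p)"
          by (simp add: cj0)
        also have "\<dots> = (\<Sum>j\<in>J'. c j * e' j i)"
          by (simp add: e'_def sum_distrib_right sum_distrib_left sum_divide_distrib sum_subtractf algebra_simps)
        finally show ?thesis .
      qed
      then show "A \<in> range (\<lambda>c. {i\<in>S. 0 < (\<Sum>j\<in>J'. c j * e' j i)})" using A by auto
    qed
    then have "card (P1 \<inter> P2) \<le> card (range (\<lambda>c. {i\<in>S. 0 < (\<Sum>j\<in>J'. c j * e' j i)}))"
      using insert.hyps by (intro card_mono) (auto intro: finite_subset[of _ "Pow S"])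
    also have "\<dots> \<le> (card S + 1) ^ card J'" using insert.IH[OF J(3)] .
    finally have "card (pat (insert p S)) \<le> (card S + 1) ^ card J' * (card S + 2)"
      using c1 c2 IH J by (simp add: algebra_simps)
    also have "\<dots> \<le> (card S + 2) ^ card J' * (card S + 2)"
      by (intro mult_right_mono power_mono) auto
    also have "\<dots> = (card (insert p S) + 1) ^ card J"
      using J insert.hyps by simp
    finally show ?thesis by (simp add: pat_def f_def)
  qed
qed

text \<open>
  If distinct members of \<open>P\<close> differ in at least \<open>\<delta> n\<close> points, then a greedily chosen point separates at
  least a fraction \<open>\<delta>\<close> of the pairs that are not separated yet, by double counting. This derandomizes
  the usual argument with \<open>N\<close> points drawn uniformly.
\<close>

lemma exists_separating_sample:
  fixes P :: "nat set set" and \<delta> :: real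
  assumes P: "finite P" "P \<subseteq> Pow {..<n}" and \<delta>: "0 < \<delta>" "\<delta> \<le> 1"
    and sep: "\<And>A B. A \<in> P \<Longrightarrow> B \<in> P \<Longrightarrow> A \<noteq> B \<Longrightarrow> \<delta> * n \<le> card (sym_diff A B)"
  shows "\<exists>S\<subseteq>{..<n}. card S \<le> N \<and>
    card {(A, B) \<in> P \<times> P. A \<noteq> B \<and> A \<inter> S = B \<inter> S} \<le> (1 - \<delta>) ^ N * (card P)\<^sup>2"
proof (induction N)
  case 0
  have "card {(A, B) \<in> P \<times> P. A \<noteq> B \<and> A \<inter> {} = B \<inter> {}} \<le> card (P \<times> P)"
    using P by (intro card_mono) auto
  then have "real (card {(A, B) \<in> P \<times> P. A \<noteq> B \<and> A \<inter> {} = B \<inter> {}}) \<le> real (card (P \<times> P))"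
    by (rule of_nat_mono)
  then show ?case
    by (intro exI[of _ "{}"]) (auto simp: card_cartesian_product power2_eq_square)
next
  case (Suc N)
  then obtain S where S: "S \<subseteq> {..<n}" "card S \<le> N" and
    U: "card {(A, B) \<in> P \<times> P. A \<noteq> B \<and> A \<inter> S = B \<inter> S} \<le> (1 - \<delta>) ^ N * (card P)\<^sup>2" by blast
  define U where "U = {(A, B) \<in> P \<times> P. A \<noteq> B \<and> A \<inter> S = B \<inter> S}"
  define V where "V = (\<lambda>i. {(A, B) \<in> U. i \<in> sym_diff A B})"
  have finU: "finite U" unfolding U_def by (rule finite_subset[of _ "P \<times> P"]) (use P in auto)
  have fS: "finite S" using S finite_subset by blast
  show ?case
  proof (cases "n = 0 \<or> U = {}")
    case True
    then have "U = {}"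
      using P by (auto simp: U_def)
    then have "real (card {(A, B) \<in> P \<times> P. A \<noteq> B \<and> A \<inter> S = B \<inter> S}) = 0"
      by (simp only: U_def[symmetric] card.empty of_nat_0)
    moreover have "0 \<le> (1 - \<delta>) ^ Suc N * (card P)\<^sup>2" using \<delta> by simp
    ultimately show ?thesis using S by (intro exI[of _ S]) auto
  next
    case False
    have "\<exists>i<n. \<delta> * card U \<le> card (V i)"
    proof (rule ccontr)
      assume "\<not> ?thesis"
      then have *: "\<And>i. i < n \<Longrightarrow> real (card (V i)) < \<delta> * card U" by (meson not_le)
      have "(\<Sum>i<n. real (card (V i))) < (\<Sum>i<n. \<delta> * card U)"
        using * False by (intro sum_strict_mono) auto
      also have "\<dots> = (\<Sum>p\<in>U. \<delta> * n)" by simp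
      also have "\<dots> \<le> (\<Sum>p\<in>U. real (card (sym_diff (fst p) (snd p))))"
      proof (rule sum_mono)
        fix p assume "p \<in> U"
        then have "fst p \<in> P" "snd p \<in> P" "fst p \<noteq> snd p"
          unfolding U_def by fastforce+
        then show "\<delta> * n \<le> real (card (sym_diff (fst p) (snd p)))" by (rule sep)
      qed
      also have "\<dots> = (\<Sum>p\<in>U. \<Sum>i<n. if i \<in> sym_diff (fst p) (snd p) then 1 else 0)"
      proof (intro sum.cong refl)
        fix p assume "p \<in> U"
        then have "fst p \<in> P" "snd p \<in> P" unfolding U_def by fastforce+
        then have "sym_diff (fst p) (snd p) \<subseteq> {..<n}" using P by blast
        then have "{..<n} \<inter> {i. i \<in> sym_diff (fst p) (snd p)} = sym_diff (fst p) (snd p)" by blast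
        then show "real (card (sym_diff (fst p) (snd p))) =
            (\<Sum>i<n. if i \<in> sym_diff (fst p) (snd p) then 1 else 0)"
          by (simp add: sum.If_cases)
      qed
      also have "\<dots> = (\<Sum>i<n. \<Sum>p\<in>U. if i \<in> sym_diff (fst p) (snd p) then 1 else 0)"
        by (rule sum.swap)
      also have "\<dots> = (\<Sum>i<n. real (card (V i)))"
      proof (intro sum.cong refl)
        fix i
        have "V i = U \<inter> {p. i \<in> sym_diff (fst p) (snd p)}" by (auto simp: V_def)
        then show "(\<Sum>p\<in>U. if i \<in> sym_diff (fst p) (snd p) then 1 else 0) = real (card (V i))"
          using finU by (simp add: sum.If_cases)
      qed
      finally show False by simp
    qed
    then obtain i where i: "i < n" "\<delta> * card U \<le> card (V i)" by blast
    have "{(A, B) \<in> P \<times> P. A \<noteq> B \<and> A \<inter> insert i S = B \<inter> insert i S} \<subseteq> U - V i"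
      by (auto simp: U_def V_def)
    then have "card {(A, B) \<in> P \<times> P. A \<noteq> B \<and> A \<inter> insert i S = B \<inter> insert i S} \<le> card (U - V i)"
      using finU by (intro card_mono) auto
    also have "\<dots> = card U - card (V i)"
      by (rule card_Diff_subset) (auto simp: V_def intro: finite_subset[OF _ finU])
    finally have "real (card {(A, B) \<in> P \<times> P. A \<noteq> B \<and> A \<inter> insert i S = B \<inter> insert i S})
        \<le> real (card U - card (V i))" by (rule of_nat_mono)
    also have "\<dots> = real (card U) - real (card (V i))"
      by (intro of_nat_diff card_mono finU) (auto simp: V_def)
    also have "\<dots> \<le> (1 - \<delta>) * card U" using i by (simp add: algebra_simps)
    also have "\<dots> \<le> (1 - \<delta>) * ((1 - \<delta>) ^ N * (card P)\<^sup>2)"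
      using U \<delta> unfolding U_def by (intro mult_left_mono) auto
    finally have "real (card {(A, B) \<in> P \<times> P. A \<noteq> B \<and> A \<inter> insert i S = B \<inter> insert i S})
        \<le> (1 - \<delta>) ^ Suc N * (card P)\<^sup>2" by simp
    moreover have "card (insert i S) \<le> Suc N" using S fS by (simp add: card_insert_if)
    ultimately show ?thesis using S i by (intro exI[of _ "insert i S"]) auto
  qed
qed

text \<open>
  After about \<open>2 ln |P| / \<delta>\<close> greedy points all members of \<open>P\<close> have distinct traces on the sample, so
  polynomial growth bounds \<open>|P|\<close> by \<open>O(ln |P| / \<delta>)\<^sup>v\<close>. Solving this crudely for \<open>ln |P|\<close> gives
  order \<open>\<delta>\<^bsup>-1/2\<^esup>\<close> instead of \<open>ln (1 / \<delta>)\<close>, which is still summable in the chaining below.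
\<close>

lemma packing_bound:
  fixes P :: "nat set set" and \<delta> :: real
  assumes P: "finite P" "P \<noteq> {}" "P \<subseteq> Pow {..<n}" and \<delta>: "0 < \<delta>" "\<delta> \<le> 1"
    and sep: "\<And>A B. A \<in> P \<Longrightarrow> B \<in> P \<Longrightarrow> A \<noteq> B \<Longrightarrow> \<delta> * n \<le> card (sym_diff A B)"
    and growth: "\<And>S. S \<subseteq> {..<n} \<Longrightarrow> card ((\<lambda>A. A \<inter> S) ` P) \<le> (card S + 1) ^ v"
  shows "(ln (card P))\<^sup>2 \<le> 189 * real v ^ 3 / \<delta>"
proof (cases "card P = 1")
  case True
  then show ?thesis using \<delta> by simp
next
  case False
  define m where "m = card P"
  define L where "L = ln (real m)"
  have m2: "m \<ge> 2" using False P by (cases m) (auto simp: m_def Suc_le_eq card_gt_0_iff)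
  have L2: "L \<ge> 2/3"
    using order_trans[OF ln2_ge_two_thirds ln_mono[of 2 "real m"]] m2 by (simp add: L_def)
  define N where "N = nat \<lceil>2 * L / \<delta>\<rceil> + 1"
  have N: "real N > 2 * L / \<delta>" "real N \<le> 2 * L / \<delta> + 2"
    using L2 \<delta> unfolding N_def by (auto simp: of_nat_ceiling) linarith+
  obtain S where S: "S \<subseteq> {..<n}" "card S \<le> N"
    and U: "card {(A, B) \<in> P \<times> P. A \<noteq> B \<and> A \<inter> S = B \<inter> S} \<le> (1 - \<delta>) ^ N * (card P)\<^sup>2"
    using exists_separating_sample[OF P(1,3) \<delta> sep] by blast
  have "(1 - \<delta>) ^ N \<le> exp (- \<delta>) ^ N"
    using \<delta> exp_ge_add_one_self[of "- \<delta>"] by (intro power_mono) auto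
  also have "\<dots> = exp (- (\<delta> * N))" by (simp add: exp_of_nat_mult[symmetric] mult.commute)
  also have "\<dots> < exp (- (2 * L))" using N(1) \<delta> by (simp add: field_simps)
  also have "\<dots> = 1 / (real m)\<^sup>2"
    using m2 by (simp add: L_def exp_minus exp_double inverse_eq_divide)
  finally have "(1 - \<delta>) ^ N * (real m)\<^sup>2 < 1" using m2 by (simp add: field_simps)
  then have "real (card {(A, B) \<in> P \<times> P. A \<noteq> B \<and> A \<inter> S = B \<inter> S}) < 1"
    using U by (simp add: m_def)
  then have "card {(A, B) \<in> P \<times> P. A \<noteq> B \<and> A \<inter> S = B \<inter> S} = 0" by simp
  moreover have "finite {(A, B) \<in> P \<times> P. A \<noteq> B \<and> A \<inter> S = B \<inter> S}"
    by (rule finite_subset[of _ "P \<times> P"]) (use P in auto)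
  ultimately have "inj_on (\<lambda>A. A \<inter> S) P" by (auto simp: inj_on_def)
  then have "m \<le> (card S + 1) ^ v" using growth[OF S(1)] by (simp add: card_image m_def)
  also have "\<dots> \<le> (N + 1) ^ v" using S by (intro power_mono) auto
  finally have "real m \<le> real (N + 1) ^ v" by (metis of_nat_le_iff of_nat_power)
  then have "L \<le> ln (real (N + 1) ^ v)" unfolding L_def using m2 by (intro ln_mono) auto
  also have "\<dots> = v * ln (real (N + 1))" by (simp add: ln_realpow)
  finally have Lv: "L \<le> v * ln (real (N + 1))" .
  \<comment> \<open>Exponential growth beats a cube, so \<open>L \<le> v ln y\<close> with \<open>y = O(L / \<delta>)\<close> forces \<open>L\<^sup>2 = O(v\<^sup>3 / \<delta>)\<close>.\<close>
  have cube: "t ^ 3 \<le> 27 * exp t" if "t \<ge> 0" for t :: real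
  proof -
    have "t / 3 \<le> exp (t / 3)" using exp_ge_add_one_self[of "t/3"] by linarith
    then have "(t / 3) ^ 3 \<le> exp (t / 3) ^ 3" using that by (intro power_mono) auto
    also have "\<dots> = exp t" by (simp add: exp_of_nat_mult[symmetric])
    finally show ?thesis by (simp add: power_divide)
  qed
  have "L ^ 3 \<le> (v * ln (real (N + 1))) ^ 3" using Lv L2 by (intro power_mono) auto
  also have "\<dots> = real v ^ 3 * ln (real (N + 1)) ^ 3" by (simp add: power_mult_distrib)
  also have "\<dots> \<le> real v ^ 3 * (27 * real (N + 1))"
    using cube[of "ln (real (N + 1))"] by (intro mult_left_mono) auto
  also have "\<dots> \<le> real v ^ 3 * (27 * (7 * L / \<delta>))"
  proof -
    have "real (N + 1) \<le> 2 * L / \<delta> + 3" using N by simp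
    also have "3 \<le> 5 * L / \<delta>" using L2 \<delta> by (simp add: field_simps)
    finally show ?thesis by (intro mult_left_mono) (auto simp: field_simps)
  qed
  finally have "L * L\<^sup>2 \<le> L * (189 * real v ^ 3 / \<delta>)"
    by (simp add: power3_eq_cube power2_eq_square field_simps)
  then have "L\<^sup>2 \<le> 189 * real v ^ 3 / \<delta>" by (rule mult_left_le_imp_le) (use L2 in simp)
  then show ?thesis by (simp add: L_def m_def)
qed

text \<open>
  Adding elements as long as the set stays \<open>r\<close>-separated leaves an \<open>r\<close>-net.
\<close>

lemma exists_separated_net:
  fixes D :: "'a \<Rightarrow> 'a \<Rightarrow> real"
  assumes "finite H" "\<And>A B. D A B = D B A" "\<And>A. D A A \<le> r"
  shows "\<exists>T\<subseteq>H. (\<forall>A\<in>T. \<forall>B\<in>T. A \<noteq> B \<longrightarrow> r < D A B) \<and> (\<forall>A\<in>H. \<exists>B\<in>T. D A B \<le> r)"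
  using assms(1)
proof induction
  case (insert A H)
  then obtain T where T: "T \<subseteq> H" "\<forall>A\<in>T. \<forall>B\<in>T. A \<noteq> B \<longrightarrow> r < D A B" "\<forall>A\<in>H. \<exists>B\<in>T. D A B \<le> r"
    by blast
  show ?case
  proof (cases "\<exists>B\<in>T. D A B \<le> r")
    case True
    then show ?thesis using T by (intro exI[of _ T]) auto
  next
    case False
    then have "\<forall>B\<in>T. r < D A B \<and> r < D B A" using assms(2) by (metis not_le)
    then show ?thesis using T assms(3) by (intro exI[of _ "insert A T"]) auto
  qed
qed simp

text \<open>
  Dudley's chaining. The nets \<open>T j\<close> have Hamming radius \<open>n / 16\<^sup>j\<close>; the first is a single set and a
  late one is all of \<open>H\<close>. Passing from \<open>T j\<close> to \<open>T (j + 1)\<close> costs the maximum of a Rademacher sum over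
  about \<open>exp (56 v\<^sup>2 4\<^sup>j)\<close> vectors of squared length \<open>n / 16\<^sup>j\<close>, which is of order \<open>v \<surd>n / 2\<^sup>j\<close>. The base
  \<open>16\<close> keeps all these scales powers of \<open>2\<close>.
\<close>

lemma rademacher_mean_sets_le:
  fixes H :: "nat set set"
  assumes H: "finite H" "H \<noteq> {}" "H \<subseteq> Pow {..<n}" and n: "n \<ge> 1" and v: "v \<ge> 1"
    and growth: "\<And>S. S \<subseteq> {..<n} \<Longrightarrow> card ((\<lambda>A. A \<inter> S) ` H) \<le> (card S + 1) ^ v"
  shows "rademacher_mean n (\<lambda>\<sigma>. Max ((\<lambda>A. \<bar>\<Sum>i<n. \<sigma> i * indicat_real A i\<bar>) ` H)) \<le> 174 * real v * sqrt n"
proof -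
  define D where "D = (\<lambda>A B :: nat set. real (card (sym_diff A B)))"
  define Y where "Y = (\<lambda>(\<sigma> :: nat \<Rightarrow> real) A. \<Sum>i<n. \<sigma> i * indicat_real A i)"
  have "\<exists>T\<subseteq>H. (\<forall>A\<in>T. \<forall>B\<in>T. A \<noteq> B \<longrightarrow> n / 16 ^ j < D A B)
      \<and> (\<forall>A\<in>H. \<exists>B\<in>T. D A B \<le> n / 16 ^ j)" for j :: nat
    using H by (intro exists_separated_net) (auto simp: D_def Un_commute)
  then obtain T where TH: "\<And>j. T j \<subseteq> H"
    and Tsep: "\<And>j A B. A \<in> T j \<Longrightarrow> B \<in> T j \<Longrightarrow> A \<noteq> B \<Longrightarrow> n / 16 ^ j < D A B"
    and Tcov: "\<And>j A. A \<in> H \<Longrightarrow> \<exists>B\<in>T j. D A B \<le> n / 16 ^ j"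
    by metis
  have finT: "finite (T j)" for j using TH H(1) finite_subset by blast
  have neT: "T j \<noteq> {}" for j using Tcov H(2) by blast
  have sq: "(\<Sum>i<n. (indicat_real A i - indicat_real B i)\<^sup>2) = D A B"
    if "A \<subseteq> {..<n}" "B \<subseteq> {..<n}" for A B
  proof -
    have "(\<Sum>i<n. (indicat_real A i - indicat_real B i)\<^sup>2)
        = (\<Sum>i<n. if i \<in> sym_diff A B then 1 else 0)"
      by (intro sum.cong) (auto simp: indicator_def)
    also have "{..<n} \<inter> {i. i \<in> sym_diff A B} = sym_diff A B" using that by blast
    then have "(\<Sum>i<n. if i \<in> sym_diff A B then 1 else (0::real)) = D A B"
      by (simp add: sum.If_cases D_def)
    finally show ?thesis .
  qed
  have Dn: "D A B \<le> n" if "A \<subseteq> {..<n}" "B \<subseteq> {..<n}" for A B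
  proof -
    have "card (sym_diff A B) \<le> card {..<n}" using that by (intro card_mono) auto
    then show ?thesis by (simp add: D_def)
  qed
  have sub: "A \<subseteq> {..<n}" if "A \<in> T j" for A j using that TH H(3) by blast
  have bound: "rademacher_mean n (\<lambda>\<sigma>. Max ((\<lambda>A. \<bar>Y \<sigma> A\<bar>) ` T j)) \<le> 58 * real v * sqrt n * (3 - 2 / 2 ^ j)" for j
  proof (induction j)
    case 0
    have "card (T 0) \<le> 1"
    proof (rule ccontr)
      assume "\<not> ?thesis"
      then obtain A B where "A \<in> T 0" "B \<in> T 0" "A \<noteq> B"
        by (metis One_nat_def card_le_Suc0_iff_eq finT)
      then show False using Tsep[of A 0 B] Dn[OF sub sub] by force
    qed
    then have c: "card (T 0) = 1" using neT[of 0] finT[of 0]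
      by (metis One_nat_def card_0_eq le_SucE le_zero_eq)
    have "rademacher_mean n (\<lambda>\<sigma>. Max ((\<lambda>A. \<bar>\<Sum>i<n. \<sigma> i * indicat_real A i\<bar>) ` T 0))
        \<le> ln (2 * card (T 0)) / (1 / sqrt n) + 1 / sqrt n * n / 2"
    proof (rule massart_finite_class)
      fix A assume "A \<in> T 0"
      then show "(\<Sum>i<n. (indicat_real A i)\<^sup>2) \<le> n"
        using sq[of A "{}"] Dn[of A "{}"] sub by fastforce
    qed (use n finT neT in auto)
    also have "\<dots> = (ln 2 + 1/2) * sqrt n"
      using n by (simp add: c field_simps)
    also have "\<dots> \<le> 58 * real v * sqrt n"
    proof (rule mult_right_mono)
      have "ln 2 + 1/2 \<le> (58::real)" using ln_le_minus_one[of "2::real"] by simp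
      also have "\<dots> \<le> 58 * real v" using v by simp
      finally show "ln 2 + 1/2 \<le> 58 * real v" .
    qed simp
    finally show ?case by (simp add: Y_def)
  next
    case (Suc j)
    obtain p where p: "\<And>A. A \<in> H \<Longrightarrow> p A \<in> T j \<and> D A (p A) \<le> n / 16 ^ j"
      using Tcov[of _ j] by metis
    let ?d = "\<lambda>A i. indicat_real A i - indicat_real (p A) i"
    have "rademacher_mean n (\<lambda>\<sigma>. Max ((\<lambda>A. \<bar>Y \<sigma> A\<bar>) ` T (Suc j)))
        \<le> rademacher_mean n (\<lambda>\<sigma>. Max ((\<lambda>A. \<bar>Y \<sigma> A\<bar>) ` T j)
            + Max ((\<lambda>A. \<bar>\<Sum>i<n. \<sigma> i * ?d A i\<bar>) ` T (Suc j)))"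
    proof (rule rademacher_mean_mono)
      fix \<sigma>
      have "\<bar>Y \<sigma> A\<bar> \<le> Max ((\<lambda>A. \<bar>Y \<sigma> A\<bar>) ` T j) + Max ((\<lambda>A. \<bar>\<Sum>i<n. \<sigma> i * ?d A i\<bar>) ` T (Suc j))"
        if A: "A \<in> T (Suc j)" for A
      proof -
        have "Y \<sigma> A = Y \<sigma> (p A) + (\<Sum>i<n. \<sigma> i * ?d A i)"
          unfolding Y_def sum.distrib[symmetric] by (intro sum.cong) (simp_all add: right_diff_distrib)
        then have "\<bar>Y \<sigma> A\<bar> \<le> \<bar>Y \<sigma> (p A)\<bar> + \<bar>\<Sum>i<n. \<sigma> i * ?d A i\<bar>" by linarith
        also have "\<bar>Y \<sigma> (p A)\<bar> \<le> Max ((\<lambda>A. \<bar>Y \<sigma> A\<bar>) ` T j)"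
          using p A TH finT by (intro Max_ge) blast+
        also have "\<bar>\<Sum>i<n. \<sigma> i * ?d A i\<bar> \<le> Max ((\<lambda>A. \<bar>\<Sum>i<n. \<sigma> i * ?d A i\<bar>) ` T (Suc j))"
          using A finT by (intro Max_ge) blast+
        finally show ?thesis by simp
      qed
      then show "Max ((\<lambda>A. \<bar>Y \<sigma> A\<bar>) ` T (Suc j)) \<le> Max ((\<lambda>A. \<bar>Y \<sigma> A\<bar>) ` T j)
            + Max ((\<lambda>A. \<bar>\<Sum>i<n. \<sigma> i * ?d A i\<bar>) ` T (Suc j))"
        using finT neT by (intro Max.boundedI) auto
    qed
    also have "\<dots> \<le> 58 * real v * sqrt n * (3 - 2 / 2 ^ j) + 58 * real v * sqrt n / 2 ^ j"
      unfolding rademacher_mean_add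
    proof (rule add_mono[OF Suc.IH])
      define m where "m = card (T (Suc j))"
      \<comment> \<open>At this scale both terms of the maximal inequality are of order \<open>v \<surd>n / 2\<^sup>j\<close>.\<close>
      define l where "l = v * 8 ^ j / sqrt n"
      have l: "l > 0" using v n by (simp add: l_def)
      have m: "m \<ge> 1" using finT neT by (simp add: m_def Suc_le_eq card_gt_0_iff)
      have "(ln (card (T (Suc j))))\<^sup>2 \<le> 189 * real v ^ 3 / (1 / 16 ^ Suc j)"
      proof (rule packing_bound)
        show "1 / 16 ^ Suc j * real n \<le> card (sym_diff A B)"
          if "A \<in> T (Suc j)" "B \<in> T (Suc j)" "A \<noteq> B" for A B
          using Tsep[OF that] by (simp add: D_def)
        show "card ((\<lambda>A. A \<inter> S) ` T (Suc j)) \<le> (card S + 1) ^ v" if "S \<subseteq> {..<n}" for S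
        proof -
          have "card ((\<lambda>A. A \<inter> S) ` T (Suc j)) \<le> card ((\<lambda>A. A \<inter> S) ` H)"
            using H TH by (intro card_mono image_mono) auto
          then show ?thesis using growth[OF that] by simp
        qed
        show "T (Suc j) \<subseteq> Pow {..<n}" using sub by blast
        show "1 / 16 ^ Suc j \<le> (1::real)" using one_le_power[of "16::real" "Suc j"] by simp
      qed (use finT neT in auto)
      also have "\<dots> \<le> (56 * (real v)\<^sup>2 * 4 ^ j)\<^sup>2"
      proof -
        have "real v ^ 3 \<le> real v ^ 4" using v by (intro power_increasing) auto
        moreover have "0 \<le> real v ^ 4" by simp
        ultimately have "189 * 16 * real v ^ 3 \<le> 3136 * real v ^ 4" by linarith
        then have "189 * 16 * real v ^ 3 * 16 ^ j \<le> 3136 * real v ^ 4 * 16 ^ j"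
          by (rule mult_right_mono) simp
        also have "\<dots> = (56 * (real v)\<^sup>2 * 4 ^ j)\<^sup>2"
        proof -
          have "(16::real) ^ j = (4 ^ j)\<^sup>2" by (simp add: power2_eq_square power_mult_distrib[symmetric])
          then show ?thesis by (simp add: power_mult_distrib)
        qed
        finally show ?thesis by (simp add: mult_ac)
      qed
      finally have "ln m \<le> 56 * (real v)\<^sup>2 * 4 ^ j"
        unfolding m_def by (rule power2_le_imp_le) simp
      moreover have "ln (2 * m) = ln 2 + ln m" using m by (simp add: ln_mult)
      moreover have "ln 2 \<le> (real v)\<^sup>2 * 4 ^ j"
      proof -
        have "ln 2 \<le> (1 :: real) * 1" using ln_le_minus_one[of "2::real"] by simp
        also have "\<dots> \<le> (real v)\<^sup>2 * 4 ^ j" using v by (intro mult_mono) auto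
        finally show ?thesis .
      qed
      ultimately have lnm: "ln (2 * m) \<le> 57 * (real v)\<^sup>2 * 4 ^ j" by simp
      have "rademacher_mean n (\<lambda>\<sigma>. Max ((\<lambda>A. \<bar>\<Sum>i<n. \<sigma> i * ?d A i\<bar>) ` T (Suc j)))
          \<le> ln (2 * card (T (Suc j))) / l + l * (n / 16 ^ j) / 2"
      proof (rule massart_finite_class)
        fix A assume A: "A \<in> T (Suc j)"
        then have "p A \<in> T j" "D A (p A) \<le> n / 16 ^ j" using p TH by blast+
        then show "(\<Sum>i<n. (?d A i)\<^sup>2) \<le> n / 16 ^ j" using sq[of A "p A"] sub A by metis
      qed (use l finT neT in auto)
      also have "\<dots> \<le> 57 * (real v)\<^sup>2 * 4 ^ j / l + l * (n / 16 ^ j) / 2"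
        using lnm l by (intro add_right_mono divide_right_mono) (auto simp: m_def)
      also have "57 * (real v)\<^sup>2 * 4 ^ j / l = 57 * real v * sqrt n / 2 ^ j"
      proof -
        have "(8::real) ^ j = 2 ^ j * 4 ^ j" by (simp add: power_mult_distrib[symmetric])
        then show ?thesis using v by (simp add: l_def field_simps power2_eq_square)
      qed
      also have "l * (n / 16 ^ j) / 2 = v * sqrt n / 2 ^ j / 2"
      proof -
        have "(16::real) ^ j = 2 ^ j * 8 ^ j" by (simp add: power_mult_distrib[symmetric])
        then have "l * (n / 16 ^ j) = v * (n / sqrt n) / 2 ^ j" by (simp add: l_def)
        then show ?thesis by (simp add: real_div_sqrt)
      qed
      also have "57 * real v * sqrt n / 2 ^ j + v * sqrt n / 2 ^ j / 2 \<le> 58 * real v * sqrt n / 2 ^ j"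
        by (simp add: field_simps)
      finally show "rademacher_mean n (\<lambda>\<sigma>. Max ((\<lambda>A. \<bar>\<Sum>i<n. \<sigma> i * ?d A i\<bar>) ` T (Suc j)))
          \<le> 58 * real v * sqrt n / 2 ^ j" .
    qed
    also have "\<dots> = 58 * real v * sqrt n * (3 - 2 / 2 ^ Suc j)" by (simp add: field_simps)
    finally show ?case .
  qed
  obtain J where J: "real n < 16 ^ J" using real_arch_pow[of 16 "real n"] by auto
  have "H \<subseteq> T J"
  proof
    fix A assume A: "A \<in> H"
    then obtain B where B: "B \<in> T J" "D A B \<le> n / 16 ^ J" using Tcov by blast
    have "n / 16 ^ J < 1" using J by (simp add: field_simps)
    with B(2) have "real (card (sym_diff A B)) < 1" unfolding D_def by linarith
    then have "card (sym_diff A B) = 0" by simp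
    moreover have "finite (sym_diff A B)"
      by (rule finite_subset[of _ "{..<n}"]) (use A B sub H in auto)
    ultimately show "A \<in> T J" using B by (metis card_0_eq Un_empty Diff_eq_empty_iff subset_antisym)
  qed
  then have "T J = H" using TH by blast
  then have "rademacher_mean n (\<lambda>\<sigma>. Max ((\<lambda>A. \<bar>Y \<sigma> A\<bar>) ` H)) \<le> 58 * real v * sqrt n * (3 - 2 / 2 ^ J)"
    using bound[of J] by simp
  also have "\<dots> \<le> 58 * real v * sqrt n * 3" by (intro mult_left_mono) auto
  finally show ?thesis by (simp add: Y_def)
qed

section \<open>Networks and half-spaces\<close>

text \<open>
  A nonnegative function is the integral of the indicators of its superlevel sets, so a bound for the
  signed sums over all superlevel sets passes to the function. On finitely many points the integral is
  a finite sum: the induction peels off the layer of height \<open>min {f i | f i > 0}\<close>, which shortens the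
  support.
\<close>

lemma layer_cake_bound:
  fixes f \<sigma> :: "nat \<Rightarrow> real"
  assumes "0 \<le> B" "\<And>i. i < n \<Longrightarrow> 0 \<le> f i \<and> f i \<le> B"
    and "\<And>s. 0 \<le> s \<Longrightarrow> \<bar>\<Sum>i<n. \<sigma> i * indicat_real {i. i < n \<and> s < f i} i\<bar> \<le> Z"
  shows "\<bar>\<Sum>i<n. \<sigma> i * f i\<bar> \<le> B * Z"
  using assms
proof (induction "card {i. i < n \<and> 0 < f i}" arbitrary: f B rule: less_induct)
  case less
  define A where "A = {i. i < n \<and> 0 < f i}"
  have Z: "0 \<le> Z" using less.prems(3)[of 0] by linarith
  have finA: "finite A" by (simp add: A_def)
  show ?case
  proof (cases "A = {}")
    case True
    then have "f i = 0" if "i < n" for i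
      using less.prems(2)[OF that] that by (force simp: A_def)
    then show ?thesis using Z less.prems(1) by simp
  next
    case False
    define m where "m = Min (f ` A)"
    have "m \<in> f ` A" unfolding m_def using False finA by (intro Min_in) auto
    then obtain p where p: "p \<in> A" "f p = m" by blast
    have m_le: "m \<le> f i" if "i \<in> A" for i using that finA by (simp add: m_def)
    have m: "0 < m" "m \<le> B" using p less.prems(2)[of p] by (auto simp: A_def)
    define f' where "f' = (\<lambda>i. f i - m * indicat_real A i)"
    have f': "0 \<le> f' i \<and> f' i \<le> B - m" if "i < n" for i
    proof (cases "i \<in> A")
      case True
      then have "f' i = f i - m" by (simp add: f'_def)
      then show ?thesis using m_le[OF True] less.prems(2)[OF that] by simp
    next
      case False
      then have "f' i = f i" "f i \<le> 0" using that by (auto simp: f'_def A_def)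
      then show ?thesis using m less.prems(2)[OF that] by simp
    qed
    have lev: "{i. i < n \<and> s < f' i} = {i. i < n \<and> s + m < f i}" if "0 \<le> s" for s
    proof -
      have "s < f' i \<longleftrightarrow> s + m < f i" if i: "i < n" for i
      proof (cases "i \<in> A")
        case False
        then have "f' i = f i" "f i \<le> 0" using i by (simp_all add: f'_def A_def)
        then show ?thesis using m \<open>0 \<le> s\<close> by linarith
      next
        case True
        then have "f' i = f i - m" by (simp add: f'_def)
        then show ?thesis by linarith
      qed
      then show ?thesis by blast
    qed
    have "{i. i < n \<and> 0 < f' i} \<subseteq> A - {p}"
    proof clarify
      fix i assume i: "i < n" "0 < f' i"
      then have "m < f i" using lev[of 0] by auto
      then show "i \<in> A - {p}" using i m p(2) by (auto simp: A_def)
    qed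
    then have "card {i. i < n \<and> 0 < f' i} \<le> card (A - {p})" using finA by (intro card_mono) auto
    also have "\<dots> < card A" using finA p by (intro psubset_card_mono) auto
    finally have smaller: "card {i. i < n \<and> 0 < f' i} < card {i. i < n \<and> 0 < f i}"
      by (simp add: A_def)
    have "\<bar>\<Sum>i<n. \<sigma> i * f' i\<bar> \<le> (B - m) * Z"
    proof (rule less.hyps[OF smaller])
      fix s :: real assume s: "0 \<le> s"
      show "\<bar>\<Sum>i<n. \<sigma> i * indicat_real {i. i < n \<and> s < f' i} i\<bar> \<le> Z"
        unfolding lev[OF s] using less.prems(3)[of "s + m"] s m by simp
    qed (use m f' in auto)
    moreover have "(\<Sum>i<n. \<sigma> i * f i) = m * (\<Sum>i<n. \<sigma> i * indicat_real A i) + (\<Sum>i<n. \<sigma> i * f' i)"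
      unfolding sum_distrib_left sum.distrib[symmetric]
      by (intro sum.cong) (simp_all add: f'_def algebra_simps)
    moreover have "\<bar>m * (\<Sum>i<n. \<sigma> i * indicat_real A i)\<bar> \<le> m * Z"
      unfolding abs_mult using m less.prems(3)[of 0] by (simp add: A_def mult_left_mono)
    ultimately have "\<bar>\<Sum>i<n. \<sigma> i * f i\<bar> \<le> m * Z + (B - m) * Z" by linarith
    then show ?thesis by (simp add: algebra_simps)
  qed
qed

definition halfspace_traces :: "nat \<Rightarrow> nat \<Rightarrow> (nat \<Rightarrow> vector) \<Rightarrow> nat set set" where
  "halfspace_traces d n x = {{i. i < n \<and> 0 < dot d w (x i) + b} | w b. True}"

definition halfspace_sup :: "nat \<Rightarrow> nat \<Rightarrow> (nat \<Rightarrow> vector) \<Rightarrow> (nat \<Rightarrow> real) \<Rightarrow> real" where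
  "halfspace_sup d n x \<sigma> =
    Max ((\<lambda>A. \<bar>\<Sum>i<n. \<sigma> i * indicat_real A i\<bar>) ` halfspace_traces d n x)"

lemma halfspace_traces_subset: "halfspace_traces d n x \<subseteq> Pow {..<n}"
  by (auto simp: halfspace_traces_def)

lemma finite_halfspace_traces: "finite (halfspace_traces d n x)"
  by (rule finite_subset[OF halfspace_traces_subset]) simp

lemma halfspace_traceI: "{i. i < n \<and> 0 < dot d w (x i) + b} \<in> halfspace_traces d n x"
  by (auto simp: halfspace_traces_def)

text \<open>
  Affine functions on \<open>\<real>\<^sup>d\<close> are spanned by the \<open>d\<close> coordinates and the constant \<open>1\<close>, so half-spaces have
  polynomial growth of exponent \<open>d + 1\<close>.
\<close>

lemma rademacher_mean_halfspace_sup_le: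
  assumes "n \<ge> 1"
  shows "rademacher_mean n (halfspace_sup d n x) \<le> 174 * (real d + 1) * sqrt n"
proof -
  have "card ((\<lambda>A. A \<inter> S) ` halfspace_traces d n x) \<le> (card S + 1) ^ (d + 1)"
    if S: "S \<subseteq> {..<n}" for S
  proof -
    let ?e = "\<lambda>j i. if j < d then x i j else 1"
    have fS: "finite S" using S finite_subset by blast
    have "(\<lambda>A. A \<inter> S) ` halfspace_traces d n x \<subseteq> range (\<lambda>c. {i\<in>S. 0 < (\<Sum>j\<in>{..d}. c j * ?e j i)})"
    proof clarify
      fix A assume "A \<in> halfspace_traces d n x"
      then obtain w b where A: "A = {i. i < n \<and> 0 < dot d w (x i) + b}"
        by (auto simp: halfspace_traces_def)
      have "(\<Sum>j\<in>{..d}. (w(d := b)) j * ?e j i) = dot d w (x i) + b" for i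
        by (simp add: lessThan_Suc_atMost[symmetric] dot_def)
      then show "A \<inter> S \<in> range (\<lambda>c. {i\<in>S. 0 < (\<Sum>j\<in>{..d}. c j * ?e j i)})"
        using S by (intro image_eqI[of _ _ "w(d := b)"]) (auto simp: A)
    qed
    then have "card ((\<lambda>A. A \<inter> S) ` halfspace_traces d n x)
        \<le> card (range (\<lambda>c. {i\<in>S. 0 < (\<Sum>j\<in>{..d}. c j * ?e j i)}))"
      using fS by (intro card_mono) (auto intro: finite_subset[of _ "Pow S"])
    also have "\<dots> \<le> (card S + 1) ^ card {..d}" by (rule card_sign_patterns_le[OF fS]) simp
    finally show ?thesis by simp
  qed
  then have "rademacher_mean n (\<lambda>\<sigma>. Max ((\<lambda>A. \<bar>\<Sum>i<n. \<sigma> i * indicat_real A i\<bar>) ` halfspace_traces d n x))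
      \<le> 174 * real (d + 1) * sqrt n"
    using halfspace_traceI[of n d _ x]
    by (intro rademacher_mean_sets_le finite_halfspace_traces halfspace_traces_subset assms) auto
  then show ?thesis unfolding halfspace_sup_def[abs_def] by (simp only: of_nat_add of_nat_1)
qed

lemma halfspace_sup_ge:
  "\<bar>\<Sum>i<n. \<sigma> i * indicat_real {i. i < n \<and> t < dot d w (x i)} i\<bar> \<le> halfspace_sup d n x \<sigma>"
proof -
  have trace: "{i. i < n \<and> t < dot d w (x i)} \<in> halfspace_traces d n x"
    using halfspace_traceI[of n d w x "- t"] by simp
  show ?thesis
    unfolding halfspace_sup_def
    by (rule Max_ge[OF finite_imageI[OF finite_halfspace_traces] image_eqI[OF refl trace]])
qed

lemma halfspace_sup_nonneg: "0 \<le> halfspace_sup d n x \<sigma>"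
  using halfspace_sup_ge abs_ge_zero order_trans by blast

text \<open>
  The superlevel sets of a monotone function of \<open>w \<bullet> x\<close> are half-spaces: on finitely many points, the
  threshold is the largest \<open>w \<bullet> x\<close> outside the superlevel set, or anything below all values if no point is
  outside. Since \<open>w\<close> and the slope of \<open>\<phi>\<close> do not enter the bound, it is uniform over steep activations.
\<close>

lemma monotone_ridge_bound:
  fixes \<phi> :: "real \<Rightarrow> real"
  assumes "mono \<phi>" "0 \<le> B" "\<And>i. i < n \<Longrightarrow> 0 \<le> \<phi> (dot d w (x i)) \<and> \<phi> (dot d w (x i)) \<le> B"
  shows "\<bar>\<Sum>i<n. \<sigma> i * \<phi> (dot d w (x i))\<bar> \<le> B * halfspace_sup d n x \<sigma>"
proof (rule layer_cake_bound)
  fix s :: real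
  let ?u = "\<lambda>i. dot d w (x i)"
  have "\<exists>t. \<forall>i<n. s < \<phi> (?u i) \<longleftrightarrow> t < ?u i"
  proof (cases "\<exists>i<n. \<phi> (?u i) \<le> s")
    case True
    define t where "t = Max (?u ` {i. i < n \<and> \<phi> (?u i) \<le> s})"
    have "t \<in> ?u ` {i. i < n \<and> \<phi> (?u i) \<le> s}" unfolding t_def using True by (intro Max_in) auto
    then have t: "\<phi> t \<le> s" by auto
    have "s < \<phi> (?u i) \<longleftrightarrow> t < ?u i" if i: "i < n" for i
    proof
      assume "s < \<phi> (?u i)"
      then show "t < ?u i" using t monoD[OF assms(1), of "?u i" t] by (cases "t < ?u i") auto
    next
      assume less: "t < ?u i"
      show "s < \<phi> (?u i)"
      proof (rule ccontr)
        assume "\<not> s < \<phi> (?u i)"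
        then have "?u i \<le> t" unfolding t_def using i by (intro Max_ge) auto
        then show False using less by simp
      qed
    qed
    then show ?thesis by blast
  next
    case False
    have "Min (insert 0 (?u ` {..<n})) - 1 < ?u i" if "i < n" for i
    proof -
      have "Min (insert 0 (?u ` {..<n})) \<le> ?u i" using that by (intro Min_le) auto
      then show ?thesis by linarith
    qed
    then show ?thesis using False by (intro exI[of _ "Min (insert 0 (?u ` {..<n})) - 1"]) force
  qed
  then obtain t where "{i. i < n \<and> s < \<phi> (?u i)} = {i. i < n \<and> t < ?u i}" by blast
  then show "\<bar>\<Sum>i<n. \<sigma> i * indicat_real {i. i < n \<and> s < \<phi> (?u i)} i\<bar> \<le> halfspace_sup d n x \<sigma>"
    using halfspace_sup_ge by simp
qed (use assms in auto)

lemma abs_dot_le: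
  assumes "\<And>j. j < d \<Longrightarrow> \<bar>x j\<bar> \<le> M"
  shows "\<bar>dot d w x\<bar> \<le> norm_one d w * M"
proof -
  have "\<bar>dot d w x\<bar> \<le> (\<Sum>j<d. \<bar>w j * x j\<bar>)" unfolding dot_def by (rule sum_abs)
  also have "\<dots> \<le> (\<Sum>j<d. \<bar>w j\<bar> * M)"
    using assms by (intro sum_mono) (auto simp: abs_mult mult_left_mono)
  finally show ?thesis by (simp add: norm_one_def sum_distrib_right)
qed

lemma norm_one_nonneg: "0 \<le> norm_one d w"
  by (simp add: norm_one_def sum_nonneg)

text \<open>
  Each hidden unit contributes \<open>a2 B\<close>. The linear part is also a monotone function of \<open>w 0 \<bullet> x\<close>, once
  \<open>a4 M\<close> is added to make it nonnegative, with range \<open>2 a4 M\<close>; removing that constant again costs another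
  \<open>a4 M\<close>, because the whole space is a half-space.
\<close>

lemma network_class_bound:
  assumes g: "g \<in> network_class d k a1 a2 a3 a4 \<phi>" and nonneg: "0 \<le> a2" "0 \<le> M" and B: "0 \<le> B"
    and \<phi>: "mono \<phi>"
    and \<phi>B: "\<And>w b i. norm_one d w \<le> a1 \<Longrightarrow> \<bar>b\<bar> \<le> a1 \<Longrightarrow> i < n \<Longrightarrow>
      0 \<le> \<phi> (dot d w (x i) + b) \<and> \<phi> (dot d w (x i) + b) \<le> B"
    and M: "\<And>i j. i < n \<Longrightarrow> j < d \<Longrightarrow> \<bar>x i j\<bar> \<le> M"
  shows "\<bar>\<Sum>i<n. \<sigma> i * g (x i)\<bar> \<le> (k * a2 * B + 3 * a4 * M + a3) * halfspace_sup d n x \<sigma>"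
proof -
  let ?Z = "halfspace_sup d n x \<sigma>"
  have Z: "0 \<le> ?Z" by (rule halfspace_sup_nonneg)
  obtain \<beta> w b where geq: "g = (\<lambda>x. (\<Sum>i=1..k. \<beta> i * \<phi> (dot d (w i) x + b i)) + dot d (w 0) x + b 0)"
    and par: "\<forall>i\<in>{1..k}. norm_one d (w i) \<le> a1 \<and> \<bar>b i\<bar> \<le> a1 \<and> \<bar>\<beta> i\<bar> \<le> a2"
    and b0: "\<bar>b 0\<bar> \<le> a3" and w0: "norm_one d (w 0) \<le> a4"
    using g[unfolded network_class_def mem_Collect_eq] by (elim exE conjE) (rule that)
  let ?S = "\<lambda>l. \<Sum>i<n. \<sigma> i * \<phi> (dot d (w l) (x i) + b l)"
  let ?L = "\<Sum>i<n. \<sigma> i * dot d (w 0) (x i)"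
  let ?O = "\<Sum>i<n. \<sigma> i"
  have "(\<Sum>i<n. \<sigma> i * g (x i)) = (\<Sum>i<n. \<Sum>l=1..k. \<beta> l * (\<sigma> i * \<phi> (dot d (w l) (x i) + b l))) + ?L + b 0 * ?O"
    unfolding geq by (simp add: algebra_simps sum.distrib sum_distrib_left)
  also have "(\<Sum>i<n. \<Sum>l=1..k. \<beta> l * (\<sigma> i * \<phi> (dot d (w l) (x i) + b l))) = (\<Sum>l=1..k. \<beta> l * ?S l)"
    by (subst sum.swap) (simp add: sum_distrib_left)
  finally have eq: "(\<Sum>i<n. \<sigma> i * g (x i)) = (\<Sum>l=1..k. \<beta> l * ?S l) + ?L + b 0 * ?O" .
  have "\<bar>\<Sum>l=1..k. \<beta> l * ?S l\<bar> \<le> (\<Sum>l=1..k. \<bar>\<beta> l * ?S l\<bar>)" by (rule sum_abs)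
  also have "\<dots> \<le> (\<Sum>l=1..k. a2 * (B * ?Z))"
  proof (rule sum_mono)
    fix l assume l: "l \<in> {1..k}"
    have "\<bar>\<Sum>i<n. \<sigma> i * (\<lambda>u. \<phi> (u + b l)) (dot d (w l) (x i))\<bar> \<le> B * ?Z"
      using bspec[OF par l] \<phi> \<phi>B B by (intro monotone_ridge_bound) (auto simp: mono_def)
    then show "\<bar>\<beta> l * ?S l\<bar> \<le> a2 * (B * ?Z)"
      using bspec[OF par l] nonneg by (simp add: abs_mult mult_mono)
  qed
  finally have 1: "\<bar>\<Sum>l=1..k. \<beta> l * ?S l\<bar> \<le> k * a2 * B * ?Z" by simp
  have "\<bar>\<Sum>i<n. \<sigma> i * (\<lambda>_. 1) (dot d (w 0) (x i))\<bar> \<le> 1 * ?Z"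
    by (rule monotone_ridge_bound) (auto simp: mono_def)
  then have O: "\<bar>?O\<bar> \<le> ?Z" by simp
  have a4: "0 \<le> a4" using w0 norm_one_nonneg order_trans by blast
  have w0M: "\<bar>dot d (w 0) (x i)\<bar> \<le> a4 * M" if "i < n" for i
  proof -
    have "\<bar>dot d (w 0) (x i)\<bar> \<le> norm_one d (w 0) * M" using M[OF that] by (rule abs_dot_le)
    also have "\<dots> \<le> a4 * M" using w0 nonneg by (intro mult_right_mono)
    finally show ?thesis .
  qed
  have "\<bar>\<Sum>i<n. \<sigma> i * (\<lambda>u. u + a4 * M) (dot d (w 0) (x i))\<bar> \<le> (2 * a4 * M) * ?Z"
  proof (rule monotone_ridge_bound)
    fix i assume "i < n"
    from w0M[OF this]
    show "0 \<le> dot d (w 0) (x i) + a4 * M \<and> dot d (w 0) (x i) + a4 * M \<le> 2 * a4 * M" by linarith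
  qed (use a4 nonneg in \<open>auto simp: mono_def\<close>)
  moreover have "(\<Sum>i<n. \<sigma> i * (\<lambda>u. u + a4 * M) (dot d (w 0) (x i))) = ?L + a4 * M * ?O"
    by (simp add: algebra_simps sum.distrib sum_distrib_left)
  moreover have "\<bar>a4 * M * ?O\<bar> \<le> a4 * M * ?Z"
    using O a4 nonneg by (simp add: abs_mult mult_left_mono)
  ultimately have 2: "\<bar>?L\<bar> \<le> 3 * a4 * M * ?Z" by linarith
  have "\<bar>b 0 * ?O\<bar> \<le> a3 * ?Z" using O b0 by (simp add: abs_mult mult_mono)
  with 1 2 show ?thesis unfolding eq distrib_right by linarith
qed

lemma mono_sigmoid: "mono sigmoid"
  by (rule monoI) (auto simp: sigmoid_def intro!: divide_left_mono mult_pos_pos add_pos_pos)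

lemma mono_relu: "mono relu"
  by (rule monoI) (auto simp: relu_def)

lemma sigmoid_bounds: "0 \<le> sigmoid z" "sigmoid z \<le> 1"
  using exp_gt_zero[of "- z"] by (simp_all add: sigmoid_def add_pos_pos divide_le_eq_1_pos)

text \<open>
  The factor \<open>k\<close> from the number of hidden units cancels against the bound \<open>2 a / k\<close> on the outer weights.
\<close>

lemma relu_class_bound:
  assumes g: "g \<in> relu_class d k a" and a: "0 \<le> a" and k: "k \<ge> 1" and M0: "0 \<le> M"
    and M: "\<And>i j. i < n \<Longrightarrow> j < d \<Longrightarrow> \<bar>x i j\<bar> \<le> M"
  shows "\<bar>\<Sum>i<n. \<sigma> i * g (x i)\<bar> \<le> a * (5 * M + 3) * halfspace_sup d n x \<sigma>"
proof -
  have "\<bar>\<Sum>i<n. \<sigma> i * g (x i)\<bar> \<le> (k * (2 * a / k) * (M + 1) + 3 * a * M + a) * halfspace_sup d n x \<sigma>"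
  proof (rule network_class_bound[OF g[unfolded relu_class_def] _ M0 _ mono_relu _ M])
    fix w and b :: real and i assume w: "norm_one d w \<le> 1" and b: "\<bar>b\<bar> \<le> 1" and i: "i < n"
    have "\<bar>dot d w (x i)\<bar> \<le> norm_one d w * M" using M[OF i] by (rule abs_dot_le)
    then have "dot d w (x i) \<le> norm_one d w * M" by linarith
    also have "\<dots> \<le> 1 * M" using w M0 by (rule mult_right_mono)
    finally show "0 \<le> relu (dot d w (x i) + b) \<and> relu (dot d w (x i) + b) \<le> M + 1"
      using b M0 by (auto simp: relu_def)
  qed (use a M0 in auto)
  also have "k * (2 * a / k) * (M + 1) + 3 * a * M + a = a * (5 * M + 3)"
    using k by (simp add: algebra_simps)
  finally show ?thesis .
qed

lemma sigmoid_class_bound: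
  assumes g: "g \<in> sigmoid_class d k a" and a: "0 \<le> a" and k: "k \<ge> 1" and M0: "0 \<le> M"
    and M: "\<And>i j. i < n \<Longrightarrow> j < d \<Longrightarrow> \<bar>x i j\<bar> \<le> M"
  shows "\<bar>\<Sum>i<n. \<sigma> i * g (x i)\<bar> \<le> a * (5 * M + 3) * halfspace_sup d n x \<sigma>"
proof -
  have "\<bar>\<Sum>i<n. \<sigma> i * g (x i)\<bar> \<le> (k * (2 * a / k) * 1 + 3 * 0 * M + a) * halfspace_sup d n x \<sigma>"
    using network_class_bound[OF g[unfolded sigmoid_class_def] _ M0 _ mono_sigmoid _ M, of 1] a sigmoid_bounds
    by simp
  also have "\<dots> \<le> a * (5 * M + 3) * halfspace_sup d n x \<sigma>"
    using k a M0 by (intro mult_right_mono halfspace_sup_nonneg) (simp add: algebra_simps)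
  finally show ?thesis .
qed

section \<open>Symmetrization with contraction\<close>

lemma integrable_rademacher_mean:
  assumes "\<And>\<sigma>. integrable M (\<Phi> \<sigma>)"
  shows "integrable M (\<lambda>x. rademacher_mean n (\<lambda>\<sigma>. \<Phi> \<sigma> x))"
  using assms
proof (induction n arbitrary: \<Phi>)
  case (Suc n)
  have "integrable M (\<lambda>x. rademacher_mean n (\<lambda>\<sigma>. \<Phi> (\<sigma>(n := e)) x))" for e
    by (rule Suc.IH) (rule Suc.prems)
  then show ?case by simp
qed simp

lemma Max_image_add_le:
  fixes f g :: "'b \<Rightarrow> real"
  assumes "finite T" "T \<noteq> {}" "\<And>s t. s \<in> T \<Longrightarrow> t \<in> T \<Longrightarrow> f s + g t \<le> r"
  shows "Max (f ` T) + Max (g ` T) \<le> r"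
proof -
  have "Max (f ` T) \<in> f ` T" "Max (g ` T) \<in> g ` T" using assms by (auto intro!: Max_in)
  then obtain s t where "s \<in> T" "t \<in> T" "Max (f ` T) = f s" "Max (g ` T) = g t" by blast
  then show ?thesis using assms(3) by simp
qed

text \<open>
  Families \<open>u\<close> and \<open>v\<close> with the same index such that increments of \<open>v\<close> are dominated by those of \<open>u\<close>.
  The instances needed are \<open>u g = g\<close> with \<open>v g = g\<close>, and \<open>u g = g\<close> with \<open>v g = h \<circ> g\<close>.
\<close>

locale contracted_process = prob_space M for M :: "'a measure" +
  fixes T :: "'b set" and u v :: "'b \<Rightarrow> 'a \<Rightarrow> real" and L B :: real
  assumes finT: "finite T" and neT: "T \<noteq> {}"
    and meas_u: "\<And>t. t \<in> T \<Longrightarrow> u t \<in> borel_measurable M"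
    and meas_v: "\<And>t. t \<in> T \<Longrightarrow> v t \<in> borel_measurable M"
    and bound_u: "\<And>t x. t \<in> T \<Longrightarrow> x \<in> space M \<Longrightarrow> \<bar>u t x\<bar> \<le> B"
    and bound_v: "\<And>t x. t \<in> T \<Longrightarrow> x \<in> space M \<Longrightarrow> \<bar>v t x\<bar> \<le> B"
    and contraction: "\<And>s t x. s \<in> T \<Longrightarrow> t \<in> T \<Longrightarrow> x \<in> space M \<Longrightarrow>
      \<bar>v s x - v t x\<bar> \<le> L * \<bar>u s x - u t x\<bar>"
begin

lemma integrable_compose:
  assumes "prob_space N" "f \<in> measurable N M" "t \<in> T"
  shows "integrable N (\<lambda>z. u t (f z))" "integrable N (\<lambda>z. v t (f z))"
proof -
  interpret N: prob_space N by fact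
  show "integrable N (\<lambda>z. u t (f z))"
    using assms meas_u bound_u measurable_space[OF assms(2)]
    by (intro N.integrable_const_bound[of _ B] AE_I2) auto
  show "integrable N (\<lambda>z. v t (f z))"
    using assms meas_v bound_v measurable_space[OF assms(2)]
    by (intro N.integrable_const_bound[of _ B] AE_I2) auto
qed

lemma integrable_u: "t \<in> T \<Longrightarrow> integrable M (u t)"
  and integrable_v: "t \<in> T \<Longrightarrow> integrable M (v t)"
  using integrable_compose[OF prob_space_axioms measurable_ident] by (auto simp: id_def)

lemma integrable_Max:
  fixes f :: "'b \<Rightarrow> 'c \<Rightarrow> real"
  assumes "\<And>t. t \<in> T \<Longrightarrow> integrable N (f t)"
  shows "integrable N (\<lambda>z. Max ((\<lambda>t. f t z) ` T))"
  using finT neT assms by (rule integrable_MAX)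

text \<open>
  Writing the expectation with an independent copy \<open>y\<close> of \<open>x\<close>, the term \<open>c t + v t x - v t y\<close> is the mean of
  \<open>c t + 2 v t x\<close> and \<open>c t - 2 v t y\<close>, and the maximum of a mean is at most the mean of the maxima. In the
  resulting sum of two maxima at the same point \<open>x\<close>, the difference \<open>2 (v s x - v t x)\<close> of the two
  maximizers is at most \<open>2 L |u s x - u t x|\<close>, which one of the two assignments of signs to \<open>s\<close> and \<open>t\<close>
  attains. The arbitrary offsets \<open>c\<close> allow iteration over the coordinates.
\<close>

lemma symmetrize_one_coordinate:
  "(\<integral>x. Max ((\<lambda>t. c t + (v t x - expectation (v t))) ` T) \<partial>M)
    \<le> (\<integral>x. (Max ((\<lambda>t. c t + 2 * L * u t x) ` T) + Max ((\<lambda>t. c t - 2 * L * u t x) ` T)) / 2 \<partial>M)"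
proof -
  let ?P = "\<lambda>x. Max ((\<lambda>t. c t + 2 * v t x) ` T)" and ?N = "\<lambda>x. Max ((\<lambda>t. c t - 2 * v t x) ` T)"
  have int: "integrable M ?P" "integrable M ?N"
    by (auto intro!: integrable_Max integrable_v)
  have int': "integrable M (\<lambda>x. Max ((\<lambda>t. c t + 2 * L * u t x) ` T))"
      "integrable M (\<lambda>x. Max ((\<lambda>t. c t - 2 * L * u t x) ` T))"
    by (auto intro!: integrable_Max integrable_u)
  have pointwise: "Max ((\<lambda>t. c t + (v t x - expectation (v t))) ` T) \<le> ?P x / 2 + expectation ?N / 2" for x
  proof -
    have "c t + (v t x - expectation (v t)) \<le> ?P x / 2 + expectation ?N / 2" if t: "t \<in> T" for t
    proof -
      have "c t + (v t x - expectation (v t)) = (c t + 2 * v t x) / 2 + (c t - 2 * expectation (v t)) / 2"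
        by (simp add: field_simps)
      also have "c t - 2 * expectation (v t) = expectation (\<lambda>y. c t - 2 * v t y)"
        using integrable_v[OF t] by (simp add: prob_space)
      also have "\<dots> \<le> expectation ?N"
        using integrable_v[OF t] int finT t by (intro integral_mono) auto
      also have "c t + 2 * v t x \<le> ?P x" using finT t by (intro Max_ge) auto
      finally show ?thesis by simp
    qed
    then show ?thesis using finT neT by (intro Max.boundedI) auto
  qed
  have "(\<integral>x. Max ((\<lambda>t. c t + (v t x - expectation (v t))) ` T) \<partial>M)
      \<le> (\<integral>x. ?P x / 2 + expectation ?N / 2 \<partial>M)"
    using int pointwise by (intro integral_mono integrable_Max integrable_v) (auto intro!: integrable_v)
  also have "\<dots> = (\<integral>x. (?P x + ?N x) / 2 \<partial>M)"
    using int by (simp add: prob_space)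
  also have "\<dots> \<le> (\<integral>x. (Max ((\<lambda>t. c t + 2 * L * u t x) ` T) + Max ((\<lambda>t. c t - 2 * L * u t x) ` T)) / 2 \<partial>M)"
  proof (rule integral_mono)
    fix x assume x: "x \<in> space M"
    have "?P x + ?N x \<le> Max ((\<lambda>t. c t + 2 * L * u t x) ` T) + Max ((\<lambda>t. c t - 2 * L * u t x) ` T)"
    proof (rule Max_image_add_le[OF finT neT])
      fix s t assume st: "s \<in> T" "t \<in> T"
      have m: "c r + 2 * L * u r x \<le> Max ((\<lambda>t. c t + 2 * L * u t x) ` T)"
        "c r - 2 * L * u r x \<le> Max ((\<lambda>t. c t - 2 * L * u t x) ` T)" if "r \<in> T" for r
        using finT that by (auto intro!: Max_ge)
      have "v s x - v t x \<le> L * \<bar>u s x - u t x\<bar>"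
        by (rule order_trans[OF abs_ge_self contraction[OF st x]])
      then have "(c s + 2 * v s x) + (c t - 2 * v t x) \<le> c s + c t + 2 * L * \<bar>u s x - u t x\<bar>" by simp
      also have "\<dots> \<le> Max ((\<lambda>t. c t + 2 * L * u t x) ` T) + Max ((\<lambda>t. c t - 2 * L * u t x) ` T)"
      proof (cases "u s x \<ge> u t x")
        case True
        then have "c s + c t + 2 * L * \<bar>u s x - u t x\<bar> = (c s + 2 * L * u s x) + (c t - 2 * L * u t x)"
          by (simp add: algebra_simps)
        then show ?thesis using m(1)[OF st(1)] m(2)[OF st(2)] by linarith
      next
        case False
        then have "c s + c t + 2 * L * \<bar>u s x - u t x\<bar> = (c t + 2 * L * u t x) + (c s - 2 * L * u s x)"
          by (simp add: algebra_simps)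
        then show ?thesis using m(1)[OF st(2)] m(2)[OF st(1)] by linarith
      qed
      finally show "c s + 2 * v s x + (c t - 2 * v t x)
          \<le> Max ((\<lambda>t. c t + 2 * L * u t x) ` T) + Max ((\<lambda>t. c t - 2 * L * u t x) ` T)" .
    qed
    then show "(?P x + ?N x) / 2 \<le> (Max ((\<lambda>t. c t + 2 * L * u t x) ` T) + Max ((\<lambda>t. c t - 2 * L * u t x) ` T)) / 2"
      by simp
  qed (use int int' in auto)
  finally show ?thesis .
qed

abbreviation "sample n \<equiv> \<Pi>\<^sub>M i\<in>{..<n::nat}. M"

lemma prob_space_sample: "prob_space (sample n)"
  by (rule prob_space_PiM) (rule prob_space_axioms)

text \<open>
  In the induction step the last coordinate is symmetrized with the others fixed, and the induction
  hypothesis is then applied to the others with the last one fixed; Fubini's theorem exchanges the two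
  integrals, and the last random sign is absorbed into the offset.
\<close>

lemma symmetrize_sample:
  "(\<integral>x. Max ((\<lambda>t. c t + (\<Sum>i<n. v t (x i) - expectation (v t))) ` T) \<partial>sample n)
    \<le> (\<integral>x. rademacher_mean n (\<lambda>\<sigma>. Max ((\<lambda>t. c t + (\<Sum>i<n. 2 * L * (\<sigma> i * u t (x i)))) ` T)) \<partial>sample n)"
proof (induction n arbitrary: c)
  case 0
  show ?case by simp
next
  case (Suc n)
  let ?p = "\<lambda>t. expectation (v t)"
  let ?A = "\<lambda>e x y. Max ((\<lambda>t. (c t + e * (2 * L * u t y)) + (\<Sum>i<n. v t (x i) - ?p t)) ` T)"
  let ?B = "\<lambda>e x y. rademacher_mean n (\<lambda>\<sigma>. Max ((\<lambda>t. (c t + e * (2 * L * u t y)) + (\<Sum>i<n. 2 * L * (\<sigma> i * u t (x i)))) ` T))"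
  let ?F = "\<lambda>x. Max ((\<lambda>t. c t + (\<Sum>i<Suc n. v t (x i) - ?p t)) ` T)"
  let ?G = "\<lambda>x. rademacher_mean (Suc n) (\<lambda>\<sigma>. Max ((\<lambda>t. c t + (\<Sum>i<Suc n. 2 * L * (\<sigma> i * u t (x i)))) ` T))"
  interpret S: prob_space "sample n" by (rule prob_space_sample)
  interpret PS: pair_prob_space "sample n" M ..
  interpret product_sigma_finite "\<lambda>_::nat. M" by standard
  have fst_comp: "(\<lambda>z. fst z i) \<in> measurable (sample n \<Otimes>\<^sub>M M) M" if "i < n" for i
    by (rule measurable_compose[OF measurable_fst measurable_component_singleton]) (use that in simp)
  have int_pair: "integrable (sample n \<Otimes>\<^sub>M M) (\<lambda>z. u t (fst z i))"
    "integrable (sample n \<Otimes>\<^sub>M M) (\<lambda>z. v t (fst z i))" if "i < n" "t \<in> T" for i t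
    using integrable_compose[OF PS.P.prob_space_axioms fst_comp] that by auto
  have int_pair': "integrable (sample n \<Otimes>\<^sub>M M) (\<lambda>z. u t (snd z))"
    "integrable (sample n \<Otimes>\<^sub>M M) (\<lambda>z. v t (snd z))" if "t \<in> T" for t
    using integrable_compose[OF PS.P.prob_space_axioms measurable_snd] that by auto
  have int_S: "integrable (sample m) (\<lambda>x. u t (x i))" "integrable (sample m) (\<lambda>x. v t (x i))"
    if "i < m" "t \<in> T" for i t m
    using that by (auto intro!: integrable_compose prob_space_sample measurable_component_singleton)
  have intA: "integrable (sample n \<Otimes>\<^sub>M M) (\<lambda>(x, y). ?A e x y)" for e
    unfolding case_prod_beta
    by (intro integrable_Max Bochner_Integration.integrable_add Bochner_Integration.integrable_sum
        Bochner_Integration.integrable_diff PS.P.integrable_const integrable_mult_right int_pair int_pair') auto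
  have intB: "integrable (sample n \<Otimes>\<^sub>M M) (\<lambda>(x, y). ?B e x y)" for e
    unfolding case_prod_beta
    by (intro integrable_rademacher_mean integrable_Max Bochner_Integration.integrable_add Bochner_Integration.integrable_sum
        PS.P.integrable_const integrable_mult_right int_pair int_pair') auto
  have intA2: "integrable (sample n \<Otimes>\<^sub>M M) (\<lambda>(x, y). (?A 1 x y + ?A (-1) x y) / 2)"
    unfolding case_prod_beta
    by (intro Bochner_Integration.integrable_divide Bochner_Integration.integrable_add
        intA[unfolded case_prod_beta])
  have intB2: "integrable (sample n \<Otimes>\<^sub>M M) (\<lambda>(x, y). (?B 1 x y + ?B (-1) x y) / 2)"
    unfolding case_prod_beta
    by (intro Bochner_Integration.integrable_divide Bochner_Integration.integrable_add
        intB[unfolded case_prod_beta])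
  have intV: "integrable (sample n \<Otimes>\<^sub>M M) (\<lambda>(x, y). Max ((\<lambda>t. (c t + (\<Sum>i<n. v t (x i) - ?p t)) + (v t y - ?p t)) ` T))"
    unfolding case_prod_beta
    by (intro integrable_Max Bochner_Integration.integrable_add Bochner_Integration.integrable_sum
        Bochner_Integration.integrable_diff PS.P.integrable_const int_pair int_pair') auto
  interpret S': prob_space "sample (Suc n)" by (rule prob_space_sample)
  have intF: "integrable (sample (Suc n)) ?F"
    by (intro integrable_Max Bochner_Integration.integrable_add Bochner_Integration.integrable_sum
        Bochner_Integration.integrable_diff S'.integrable_const int_S) auto
  have intG: "integrable (sample (Suc n)) ?G"
    by (intro integrable_rademacher_mean integrable_Max Bochner_Integration.integrable_add Bochner_Integration.integrable_sum
        S'.integrable_const integrable_mult_right int_S) auto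
  have upd: "(\<Sum>i<n. f i ((x(n := y)) i)) = (\<Sum>i<n. f i (x i))" for f :: "nat \<Rightarrow> 'c \<Rightarrow> real" and x y
    by (intro sum.cong) auto
  have "(\<integral>x. ?F x \<partial>sample (Suc n)) = (\<integral>x. (\<integral>y. ?F (x(n := y)) \<partial>M) \<partial>sample n)"
    using product_integral_insert[of "{..<n}" n ?F] intF by (simp add: lessThan_Suc)
  also have "\<dots> = (\<integral>x. (\<integral>y. Max ((\<lambda>t. (c t + (\<Sum>i<n. v t (x i) - ?p t)) + (v t y - ?p t)) ` T) \<partial>M) \<partial>sample n)"
    by (simp add: add.assoc)
  also have "\<dots> \<le> (\<integral>x. (\<integral>y. (?A 1 x y + ?A (-1) x y) / 2 \<partial>M) \<partial>sample n)"
  proof (rule integral_mono)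
    fix x
    show "(\<integral>y. Max ((\<lambda>t. (c t + (\<Sum>i<n. v t (x i) - ?p t)) + (v t y - ?p t)) ` T) \<partial>M)
        \<le> (\<integral>y. (?A 1 x y + ?A (-1) x y) / 2 \<partial>M)"
      using symmetrize_one_coordinate[of "\<lambda>t. c t + (\<Sum>i<n. v t (x i) - ?p t)"]
      by (simp add: algebra_simps)
  qed (use PS.integrable_fst'[OF intV] PS.integrable_fst'[OF intA2] in simp_all)
  also have "\<dots> = (\<integral>y. (\<integral>x. (?A 1 x y + ?A (-1) x y) / 2 \<partial>sample n) \<partial>M)"
    by (rule PS.Fubini_integral[symmetric, OF intA2])
  also have "\<dots> \<le> (\<integral>y. (\<integral>x. (?B 1 x y + ?B (-1) x y) / 2 \<partial>sample n) \<partial>M)"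
  proof (rule integral_mono)
    fix y assume y: "y \<in> space M"
    have i: "integrable (sample n) (\<lambda>x. ?A e x y)" "integrable (sample n) (\<lambda>x. ?B e x y)" for e
      by (intro integrable_rademacher_mean integrable_Max Bochner_Integration.integrable_add
          Bochner_Integration.integrable_sum Bochner_Integration.integrable_diff
          S.integrable_const integrable_mult_right int_S; simp)+
    have "(\<integral>x. ?A e x y \<partial>sample n) \<le> (\<integral>x. ?B e x y \<partial>sample n)" for e
      by (rule Suc.IH)
    from this[of 1] this[of "-1"]
    show "(\<integral>x. (?A 1 x y + ?A (-1) x y) / 2 \<partial>sample n) \<le> (\<integral>x. (?B 1 x y + ?B (-1) x y) / 2 \<partial>sample n)"
      using i[of 1] i[of "-1"] by simp
  qed (use PS.integrable_snd[OF intA2] PS.integrable_snd[OF intB2] in simp_all)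
  also have "\<dots> = (\<integral>x. (\<integral>y. (?B 1 x y + ?B (-1) x y) / 2 \<partial>M) \<partial>sample n)"
    by (rule PS.Fubini_integral[OF intB2])
  also have "\<dots> = (\<integral>x. (\<integral>y. ?G (x(n := y)) \<partial>M) \<partial>sample n)"
  proof -
    have "?G (x(n := y)) = (?B 1 x y + ?B (-1) x y) / 2" for x y
    proof -
      have "c t + (\<Sum>i<Suc n. 2 * L * ((\<sigma>(n := e)) i * u t ((x(n := y)) i)))
          = (c t + e * (2 * L * u t y)) + (\<Sum>i<n. 2 * L * (\<sigma> i * u t (x i)))" for \<sigma> e t
        by (simp add: algebra_simps)
      then show ?thesis by (simp only: rademacher_mean.simps)
    qed
    then show ?thesis by presburger
  qed
  also have "\<dots> = (\<integral>x. ?G x \<partial>sample (Suc n))"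
    using product_integral_insert[of "{..<n}" n ?G] intG by (simp add: lessThan_Suc)
  finally show ?case .
qed

end

context contracted_process
begin

lemma expected_max_le:
  assumes L: "0 \<le> L"
    and R: "\<And>x. x \<in> space (sample n) \<Longrightarrow>
      rademacher_mean n (\<lambda>\<sigma>. Max ((\<lambda>t. \<bar>\<Sum>i<n. \<sigma> i * u t (x i)\<bar>) ` T)) \<le> R"
  shows "(\<integral>x. Max ((\<lambda>t. \<Sum>i<n. v t (x i) - expectation (v t)) ` T) \<partial>sample n) \<le> 2 * L * R"
proof -
  interpret S: prob_space "sample n" by (rule prob_space_sample)
  let ?G = "\<lambda>x. rademacher_mean n (\<lambda>\<sigma>. Max ((\<lambda>t. 0 + (\<Sum>i<n. 2 * L * (\<sigma> i * u t (x i)))) ` T))"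
  have int: "integrable (sample n) (\<lambda>x. u t (x i))" if "i < n" "t \<in> T" for i t
    using that by (auto intro!: integrable_compose prob_space_sample measurable_component_singleton)
  have intG: "integrable (sample n) ?G"
    by (intro integrable_rademacher_mean integrable_Max Bochner_Integration.integrable_add
        Bochner_Integration.integrable_sum S.integrable_const integrable_mult_right int) auto
  have G: "?G x \<le> 2 * L * R" if x: "x \<in> space (sample n)" for x
  proof -
    let ?Y = "\<lambda>\<sigma> t. \<Sum>i<n. \<sigma> i * u t (x i)"
    have "?G x \<le> rademacher_mean n (\<lambda>\<sigma>. 2 * L * Max ((\<lambda>t. \<bar>?Y \<sigma> t\<bar>) ` T))"
    proof (rule rademacher_mean_mono)
      fix \<sigma>
      have "0 + (\<Sum>i<n. 2 * L * (\<sigma> i * u t (x i))) \<le> 2 * L * Max ((\<lambda>t. \<bar>?Y \<sigma> t\<bar>) ` T)" if t: "t \<in> T" for t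
      proof -
        have "?Y \<sigma> t \<le> Max ((\<lambda>t. \<bar>?Y \<sigma> t\<bar>) ` T)"
          using t finT by (intro order_trans[OF abs_ge_self Max_ge]) auto
        then have "2 * L * ?Y \<sigma> t \<le> 2 * L * Max ((\<lambda>t. \<bar>?Y \<sigma> t\<bar>) ` T)"
          using L by (intro mult_left_mono) auto
        then show ?thesis by (simp add: sum_distrib_left)
      qed
      then show "Max ((\<lambda>t. 0 + (\<Sum>i<n. 2 * L * (\<sigma> i * u t (x i)))) ` T)
          \<le> 2 * L * Max ((\<lambda>t. \<bar>?Y \<sigma> t\<bar>) ` T)"
        using finT neT by (intro Max.boundedI) auto
    qed
    also have "\<dots> \<le> 2 * L * R"
      unfolding rademacher_mean_cmult using L R[OF x] by (intro mult_left_mono) auto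
    finally show ?thesis .
  qed
  have "(\<integral>x. Max ((\<lambda>t. \<Sum>i<n. v t (x i) - expectation (v t)) ` T) \<partial>sample n) \<le> (\<integral>x. ?G x \<partial>sample n)"
    using symmetrize_sample[where c = "\<lambda>_. 0" and n = n] by simp
  also have "\<dots> \<le> (\<integral>x. 2 * L * R \<partial>sample n)"
    using intG G by (intro integral_mono S.integrable_const) auto
  also have "\<dots> = 2 * L * R" by (simp add: S.prob_space)
  finally show ?thesis .
qed

text \<open>
  The index \<open>t0\<close> has a constant \<open>v t0\<close>, hence no deviation, so the one-sided maxima of the deviations and of
  their negatives are nonnegative and their sum dominates the maximum of the absolute values. This way the
  contraction argument is needed only without absolute values.
\<close>

lemma expected_max_abs_le:
  assumes L: "0 \<le> L"
    and t0: "t0 \<in> T" "\<And>x. x \<in> space M \<Longrightarrow> v t0 x = \<kappa>"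
    and R: "\<And>x. x \<in> space (sample n) \<Longrightarrow>
      rademacher_mean n (\<lambda>\<sigma>. Max ((\<lambda>t. \<bar>\<Sum>i<n. \<sigma> i * u t (x i)\<bar>) ` T)) \<le> R"
  shows "(\<integral>\<^sup>+x. ennreal (Max ((\<lambda>t. \<bar>\<Sum>i<n. v t (x i) - expectation (v t)\<bar>) ` T)) \<partial>sample n)
    \<le> ennreal (4 * L * R)"
proof -
  interpret neg: contracted_process M T u "\<lambda>t x. - v t x" L B
    using finT neT meas_u meas_v bound_u bound_v contraction
    by unfold_locales (auto simp: abs_minus_commute)
  interpret S: prob_space "sample n" by (rule prob_space_sample)
  let ?D = "\<lambda>t x. \<Sum>i<n. v t (x i) - expectation (v t)"
  have intD: "integrable (sample n) (?D t)" if "t \<in> T" for t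
    using that by (auto intro!: integrable_compose prob_space_sample measurable_component_singleton
        Bochner_Integration.integrable_sum Bochner_Integration.integrable_diff)
  have "expectation (v t0) = \<kappa>"
    using t0(2) by (simp add: prob_space cong: Bochner_Integration.integral_cong)
  then have D0: "?D t0 x = 0" if "x \<in> space (sample n)" for x
    using that t0(2) by (auto simp: space_PiM PiE_iff)
  have "Max ((\<lambda>t. \<bar>?D t x\<bar>) ` T) \<le> Max ((\<lambda>t. ?D t x) ` T) + Max ((\<lambda>t. - ?D t x) ` T)"
    if x: "x \<in> space (sample n)" for x
  proof -
    have m: "?D t x \<le> Max ((\<lambda>t. ?D t x) ` T)" "- ?D t x \<le> Max ((\<lambda>t. - ?D t x) ` T)" if "t \<in> T" for t
      using that finT by (auto intro!: Max_ge)
    have "\<bar>?D t x\<bar> \<le> Max ((\<lambda>t. ?D t x) ` T) + Max ((\<lambda>t. - ?D t x) ` T)" if "t \<in> T" for t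
      using m[OF that] m[OF t0(1)] D0[OF x] by linarith
    then show ?thesis using finT neT by (intro Max.boundedI) auto
  qed
  then have "(\<integral>x. Max ((\<lambda>t. \<bar>?D t x\<bar>) ` T) \<partial>sample n)
      \<le> (\<integral>x. Max ((\<lambda>t. ?D t x) ` T) + Max ((\<lambda>t. - ?D t x) ` T) \<partial>sample n)"
    by (intro integral_mono Bochner_Integration.integrable_add integrable_Max
        integrable_abs Bochner_Integration.integrable_minus intD) auto
  also have "\<dots> = (\<integral>x. Max ((\<lambda>t. ?D t x) ` T) \<partial>sample n) + (\<integral>x. Max ((\<lambda>t. - ?D t x) ` T) \<partial>sample n)"
    by (intro Bochner_Integration.integral_add integrable_Max Bochner_Integration.integrable_minus intD)
  also have "\<dots> \<le> 2 * L * R + 2 * L * R"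
  proof (rule add_mono)
    show "(\<integral>x. Max ((\<lambda>t. ?D t x) ` T) \<partial>sample n) \<le> 2 * L * R"
      by (rule expected_max_le[OF L R])
    have "(\<Sum>i<n. - v t (x i) - expectation (\<lambda>x. - v t x)) = - ?D t x" for t x
      by (simp add: sum_negf[symmetric])
    then show "(\<integral>x. Max ((\<lambda>t. - ?D t x) ` T) \<partial>sample n) \<le> 2 * L * R"
      using neg.expected_max_le[OF L R] by simp
  qed
  finally have "(\<integral>x. Max ((\<lambda>t. \<bar>?D t x\<bar>) ` T) \<partial>sample n) \<le> 4 * L * R" by simp
  moreover have "0 \<le> Max ((\<lambda>t. \<bar>?D t x\<bar>) ` T)" for x
    using finT t0(1) by (intro order_trans[OF abs_ge_zero Max_ge]) auto
  ultimately show ?thesis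
    by (subst nn_integral_eq_integral)
      (auto intro!: ennreal_leI integrable_Max integrable_abs intD)
qed

end

text \<open>
  A countable class is an increasing union of finite classes containing \<open>t0\<close>.
\<close>

lemma (in prob_space) countable_class_deviation:
  fixes T :: "'b set" and u v :: "'b \<Rightarrow> 'a \<Rightarrow> real"
  assumes T: "countable T" "t0 \<in> T" and L: "0 \<le> L"
    and meas: "\<And>t. t \<in> T \<Longrightarrow> u t \<in> borel_measurable M" "\<And>t. t \<in> T \<Longrightarrow> v t \<in> borel_measurable M"
    and bound: "\<And>t x. t \<in> T \<Longrightarrow> x \<in> space M \<Longrightarrow> \<bar>u t x\<bar> \<le> B"
      "\<And>t x. t \<in> T \<Longrightarrow> x \<in> space M \<Longrightarrow> \<bar>v t x\<bar> \<le> B"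
    and contraction: "\<And>s t x. s \<in> T \<Longrightarrow> t \<in> T \<Longrightarrow> x \<in> space M \<Longrightarrow>
      \<bar>v s x - v t x\<bar> \<le> L * \<bar>u s x - u t x\<bar>"
    and const: "\<And>x. x \<in> space M \<Longrightarrow> v t0 x = \<kappa>"
    and R: "\<And>F x. finite F \<Longrightarrow> F \<noteq> {} \<Longrightarrow> F \<subseteq> T \<Longrightarrow> x \<in> {..<n} \<rightarrow> space M \<Longrightarrow>
      rademacher_mean n (\<lambda>\<sigma>. Max ((\<lambda>t. \<bar>\<Sum>i<n. \<sigma> i * u t (x i)\<bar>) ` F)) \<le> R"
  shows "(\<integral>\<^sup>+x. (SUP t\<in>T. ennreal \<bar>\<Sum>i<n. v t (x i) - expectation (v t)\<bar>) \<partial>(\<Pi>\<^sub>M i\<in>{..<n}. M))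
    \<le> ennreal (4 * L * R)"
proof -
  let ?S = "\<Pi>\<^sub>M i\<in>{..<n}. M"
  let ?D = "\<lambda>t x. \<bar>\<Sum>i<n. v t (x i) - expectation (v t)\<bar>"
  define F where "F = (\<lambda>m. insert t0 (from_nat_into T ` {..<m}))"
  have F: "finite (F m)" "F m \<noteq> {}" "F m \<subseteq> T" "t0 \<in> F m" for m
    using T from_nat_into[of T] by (auto simp: F_def)
  have Fmono: "F m \<subseteq> F m'" if "m \<le> m'" for m m' using that by (auto simp: F_def)
  have process: "contracted_process M (F m) u v L B" for m
    using F[of m] meas bound contraction by unfold_locales blast+
  have le: "(\<integral>\<^sup>+x. ennreal (Max ((\<lambda>t. ?D t x) ` F m)) \<partial>?S) \<le> ennreal (4 * L * R)" for m
    using F const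
    by (intro contracted_process.expected_max_abs_le[OF process L] R) (auto simp: space_PiM)
  have measD: "?D t \<in> borel_measurable ?S" if "t \<in> T" for t
  proof -
    have "(\<lambda>x. v t (x i)) \<in> borel_measurable ?S" if "i < n" for i
      by (rule measurable_compose[OF _ meas(2)[OF \<open>t \<in> T\<close>]])
        (rule measurable_component_singleton, use that in simp)
    then show ?thesis
      by (intro borel_measurable_abs borel_measurable_sum borel_measurable_diff borel_measurable_const) auto
  qed
  have "(\<integral>\<^sup>+x. (SUP t\<in>T. ennreal (?D t x)) \<partial>?S) \<le> (\<integral>\<^sup>+x. (SUP m. ennreal (Max ((\<lambda>t. ?D t x) ` F m))) \<partial>?S)"
  proof (intro nn_integral_mono SUP_least)
    fix x t assume t: "t \<in> T"
    have "t \<in> F (Suc (to_nat_on T t))"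
      using t T by (auto simp: F_def intro!: image_eqI[of _ _ "to_nat_on T t"])
    then have "?D t x \<le> Max ((\<lambda>t. ?D t x) ` F (Suc (to_nat_on T t)))"
      using F by (intro Max_ge) auto
    then show "ennreal (?D t x) \<le> (SUP m. ennreal (Max ((\<lambda>t. ?D t x) ` F m)))"
      by (intro SUP_upper2[of "Suc (to_nat_on T t)"] ennreal_leI) auto
  qed
  also have "\<dots> = (SUP m. \<integral>\<^sup>+x. ennreal (Max ((\<lambda>t. ?D t x) ` F m)) \<partial>?S)"
  proof (rule nn_integral_monotone_convergence_SUP)
    show "incseq (\<lambda>m x. ennreal (Max ((\<lambda>t. ?D t x) ` F m)))"
      by (intro incseq_SucI le_funI ennreal_leI Max_mono image_mono Fmono) (use F in auto)
    show "(\<lambda>x. ennreal (Max ((\<lambda>t. ?D t x) ` F m))) \<in> borel_measurable ?S" for m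
      using F by (intro measurable_compose[OF _ measurable_ennreal] borel_measurable_Max measD) auto
  qed
  also have "\<dots> \<le> ennreal (4 * L * R)" using le by (intro SUP_least)
  finally show ?thesis .
qed

text \<open>
  Passing to a dense subset makes the bound a supremum over \<open>T\<close>, hence measurable in the application,
  where \<open>A\<close> depends on the sample.
\<close>

lemma abs_SUP_diff_le_SUP_dense:
  fixes A B :: "'b \<Rightarrow> real"
  assumes T: "T \<subseteq> G" "T \<noteq> {}" and bound: "\<And>g. g \<in> G \<Longrightarrow> \<bar>A g\<bar> \<le> c" "\<And>g. g \<in> G \<Longrightarrow> \<bar>B g\<bar> \<le> c"
    and dense: "\<And>g. g \<in> G \<Longrightarrow> \<exists>s. (\<forall>m. s m \<in> T) \<and> (\<lambda>m. A (s m)) \<longlonglongrightarrow> A g \<and> (\<lambda>m. B (s m)) \<longlonglongrightarrow> B g"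
  shows "e2ennreal \<bar>(SUP g\<in>G. ereal (A g)) - (SUP g\<in>G. ereal (B g))\<bar> \<le> (SUP t\<in>T. ennreal \<bar>A t - B t\<bar>)"
proof -
  define S where "S = (SUP t\<in>T. ennreal \<bar>A t - B t\<bar>)"
  define r where "r = enn2real S"
  have "S \<le> ennreal (2 * c)"
    unfolding S_def
  proof (intro SUP_least ennreal_leI)
    fix t assume "t \<in> T"
    then show "\<bar>A t - B t\<bar> \<le> 2 * c" using bound[of t] T by force
  qed
  then have S: "S = ennreal r" unfolding r_def
    using ennreal_enn2real[of S] by (metis ennreal_less_top le_less_trans)
  have r0: "0 \<le> r" by (simp add: r_def)
  have rT: "\<bar>A t - B t\<bar> \<le> r" if "t \<in> T" for t
  proof -
    have "ennreal \<bar>A t - B t\<bar> \<le> S" unfolding S_def by (rule SUP_upper[OF that])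
    then show ?thesis using r0 by (simp add: S)
  qed
  have rG: "\<bar>A g - B g\<bar> \<le> r" if g: "g \<in> G" for g
  proof -
    obtain s where s: "\<And>m. s m \<in> T" "(\<lambda>m. A (s m)) \<longlonglongrightarrow> A g" "(\<lambda>m. B (s m)) \<longlonglongrightarrow> B g"
      using dense[OF g] by blast
    have "(\<lambda>m. \<bar>A (s m) - B (s m)\<bar>) \<longlonglongrightarrow> \<bar>A g - B g\<bar>" by (intro tendsto_intros s)
    then show ?thesis by (rule LIMSEQ_le_const2) (use rT s(1) in blast)
  qed
  obtain t where t: "t \<in> G" using T by blast
  have fin: "\<bar>SUP g\<in>G. ereal (f g)\<bar> \<noteq> \<infinity>" if "\<And>g. g \<in> G \<Longrightarrow> \<bar>f g\<bar> \<le> c" for f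
  proof -
    have "ereal (f t) \<le> (SUP g\<in>G. ereal (f g))" using t by (rule SUP_upper)
    moreover have "(SUP g\<in>G. ereal (f g)) \<le> ereal c" using that by (intro SUP_least) (auto simp: abs_le_iff)
    ultimately show ?thesis by auto
  qed
  obtain x where x: "(SUP g\<in>G. ereal (A g)) = ereal x" using fin[of A, OF bound(1)] by (cases "SUP g\<in>G. ereal (A g)") auto
  obtain y where y: "(SUP g\<in>G. ereal (B g)) = ereal y" using fin[of B, OF bound(2)] by (cases "SUP g\<in>G. ereal (B g)") auto
  have "ereal x \<le> ereal (y + r)" unfolding x[symmetric]
  proof (rule SUP_least)
    fix g assume g: "g \<in> G"
    have "ereal (B g) \<le> ereal y" unfolding y[symmetric] using g by (rule SUP_upper)
    then show "ereal (A g) \<le> ereal (y + r)" using rG[OF g] by (simp add: abs_le_iff)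
  qed
  moreover have "ereal y \<le> ereal (x + r)" unfolding y[symmetric]
  proof (rule SUP_least)
    fix g assume g: "g \<in> G"
    have "ereal (A g) \<le> ereal x" unfolding x[symmetric] using g by (rule SUP_upper)
    then show "ereal (B g) \<le> ereal (x + r)" using rG[OF g] by (simp add: abs_le_iff)
  qed
  ultimately have "\<bar>x - y\<bar> \<le> r" by (simp add: abs_le_iff)
  then have "ennreal \<bar>x - y\<bar> \<le> ennreal r" by (rule ennreal_leI)
  then show ?thesis
    by (simp add: x y S_def[symmetric] S ennreal.abs_eq[symmetric] e2ennreal_ereal)
qed

section \<open>Regularity of the network classes\<close>

lemma nn_integral_pair_add:
  assumes "prob_space P" "prob_space Q" and [measurable]: "f \<in> borel_measurable P" "g \<in> borel_measurable Q"
  shows "(\<integral>\<^sup>+\<omega>. f (fst \<omega>) + g (snd \<omega>) \<partial>(P \<Otimes>\<^sub>M Q)) = (\<integral>\<^sup>+x. f x \<partial>P) + (\<integral>\<^sup>+y. g y \<partial>Q)"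
proof -
  interpret P: prob_space P by fact
  interpret Q: prob_space Q by fact
  have "(\<integral>\<^sup>+\<omega>. f (fst \<omega>) + g (snd \<omega>) \<partial>(P \<Otimes>\<^sub>M Q)) = (\<integral>\<^sup>+x. \<integral>\<^sup>+y. f x + g y \<partial>Q \<partial>P)"
    by (subst Q.nn_integral_fst[symmetric]) auto
  also have "\<dots> = (\<integral>\<^sup>+x. f x + (\<integral>\<^sup>+y. g y \<partial>Q) \<partial>P)"
    by (intro nn_integral_cong) (simp add: nn_integral_add Q.emeasure_space_1)
  also have "\<dots> = (\<integral>\<^sup>+x. f x \<partial>P) + (\<integral>\<^sup>+y. g y \<partial>Q)"
    by (simp add: nn_integral_add P.emeasure_space_1)
  finally show ?thesis .
qed

lemma ext_expectation_real:
  assumes "integrable M f"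
  shows "ext_expectation M (\<lambda>x. ereal (f x)) = ereal (\<integral>x. f x \<partial>M)"
proof -
  have "(\<integral>\<^sup>+x. ennreal (f x) \<partial>M) < \<infinity>" "(\<integral>\<^sup>+x. ennreal (- f x) \<partial>M) < \<infinity>"
    using assms by (auto simp: real_integrable_def top.not_eq_extremum)
  then have *: "enn2ereal (\<integral>\<^sup>+x. ennreal (f x) \<partial>M) = ereal (enn2real (\<integral>\<^sup>+x. ennreal (f x) \<partial>M))"
    "enn2ereal (\<integral>\<^sup>+x. ennreal (- f x) \<partial>M) = ereal (enn2real (\<integral>\<^sup>+x. ennreal (- f x) \<partial>M))"
    by (metis enn2ereal_ennreal enn2real_nonneg ennreal_enn2real infinity_ennreal_def)+
  show ?thesis
    using real_lebesgue_integral_def[OF assms] by (simp add: ext_expectation_def *)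
qed

text \<open>
  Only the parameters in which a network is linear are scaled: the outer weights \<open>\<beta>\<close>, the linear part
  \<open>w 0\<close> and the additive constant \<open>b 0\<close>. With \<open>l = 0\<close> to \<open>1\<close> this makes the class star-shaped about \<open>0\<close>.
\<close>

lemma network_class_scale:
  assumes g: "g \<in> network_class d k a1 a2 a3 a4 \<phi>" and l: "0 \<le> l" "l \<le> 1"
  shows "(\<lambda>x. l * g x) \<in> network_class d k a1 a2 a3 a4 \<phi>"
proof -
  obtain \<beta> w b where geq: "g = (\<lambda>x. (\<Sum>i=1..k. \<beta> i * \<phi> (dot d (w i) x + b i)) + dot d (w 0) x + b 0)"
    and par: "\<forall>i\<in>{1..k}. norm_one d (w i) \<le> a1 \<and> \<bar>b i\<bar> \<le> a1 \<and> \<bar>\<beta> i\<bar> \<le> a2"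
    and b0: "\<bar>b 0\<bar> \<le> a3" and w0: "norm_one d (w 0) \<le> a4"
    using g[unfolded network_class_def mem_Collect_eq] by (elim exE conjE) (rule that)
  define \<beta>' where "\<beta>' = (\<lambda>i. l * \<beta> i)"
  define w' where "w' = w(0 := (\<lambda>j. l * w 0 j))"
  define b' where "b' = b(0 := l * b 0)"
  have shrink: "l * y \<le> z" if "0 \<le> y" "y \<le> z" for y z :: real
    using mult_mono[of l 1 y z] that l by simp
  have dot0: "dot d (w' 0) x = l * dot d (w 0) x" for x
    by (simp add: w'_def dot_def sum_distrib_left mult.assoc)
  have sum: "(\<Sum>i=1..k. \<beta>' i * \<phi> (dot d (w' i) x + b' i)) = l * (\<Sum>i=1..k. \<beta> i * \<phi> (dot d (w i) x + b i))" for x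
    unfolding sum_distrib_left by (intro sum.cong) (auto simp: \<beta>'_def w'_def b'_def)
  have "(\<lambda>x. l * g x) = (\<lambda>x. (\<Sum>i=1..k. \<beta>' i * \<phi> (dot d (w' i) x + b' i)) + dot d (w' 0) x + b' 0)"
    unfolding sum dot0 by (simp add: geq b'_def distrib_left)
  moreover have "\<forall>i\<in>{1..k}. norm_one d (w' i) \<le> a1 \<and> \<bar>b' i\<bar> \<le> a1 \<and> \<bar>\<beta>' i\<bar> \<le> a2"
    using par l by (auto simp: \<beta>'_def w'_def b'_def abs_mult intro!: shrink)
  moreover have "\<bar>b' 0\<bar> \<le> a3"
    using b0 l by (auto simp: b'_def abs_mult intro!: shrink)
  moreover have "norm_one d (w' 0) \<le> a4"
  proof -
    have "norm_one d (w' 0) = l * norm_one d (w 0)"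
      using l by (simp add: w'_def norm_one_def abs_mult sum_distrib_left)
    then show ?thesis using shrink[OF norm_one_nonneg w0] by simp
  qed
  ultimately show ?thesis unfolding network_class_def mem_Collect_eq by blast
qed

lemma zero_in_network_class:
  assumes "0 \<le> a1" "0 \<le> a2" "0 \<le> a3" "0 \<le> a4"
  shows "(\<lambda>x. 0) \<in> network_class d k a1 a2 a3 a4 \<phi>"
  unfolding network_class_def mem_Collect_eq
  by (intro exI[of _ "\<lambda>_. 0"] exI[of _ "\<lambda>_ _. 0"]) (use assms in \<open>auto simp: dot_def norm_one_def\<close>)

lemma measurable_dot: "dot d w \<in> borel_measurable (Rd d)"
  unfolding dot_def[abs_def] Rd_def
  by (intro borel_measurable_sum borel_measurable_times borel_measurable_const
      measurable_component_singleton) auto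

lemma network_class_measurable:
  assumes g: "g \<in> network_class d k a1 a2 a3 a4 \<phi>" and [measurable]: "\<phi> \<in> borel_measurable borel"
  shows "g \<in> borel_measurable (Rd d)"
proof -
  obtain \<beta> w b where geq: "g = (\<lambda>x. (\<Sum>i=1..k. \<beta> i * \<phi> (dot d (w i) x + b i)) + dot d (w 0) x + b 0)"
    using g[unfolded network_class_def mem_Collect_eq] by (elim exE conjE) (rule that)
  note [measurable] = measurable_dot
  show ?thesis unfolding geq by measurable
qed

lemma tendsto_coordinate:
  fixes h :: "nat \<Rightarrow> 'i \<Rightarrow> 'z::topological_space"
  assumes "h \<longlonglongrightarrow> l"
  shows "(\<lambda>m. h m i) \<longlonglongrightarrow> l i"
  by (rule continuous_on_tendsto_compose[OF continuous_on_product_coordinates assms]) auto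

text \<open>
  The parameters lie in a product of countably many real lines, which is separable and metrizable, and a
  network is a pointwise continuous function of them. So a countable dense set of admissible parameters
  gives a dense subclass.
\<close>

lemma network_class_countable_dense:
  assumes \<phi>: "continuous_on UNIV \<phi>"
  shows "\<exists>T. countable T \<and> T \<subseteq> network_class d k a1 a2 a3 a4 \<phi> \<and>
    (\<forall>g\<in>network_class d k a1 a2 a3 a4 \<phi>. \<exists>s. (\<forall>m. s m \<in> T) \<and> (\<forall>x. (\<lambda>m. s m x) \<longlonglongrightarrow> g x))"
proof -
  define net where "net = (\<lambda>(\<beta> :: nat \<Rightarrow> real, w :: nat \<Rightarrow> nat \<Rightarrow> real, b :: nat \<Rightarrow> real) x.
    (\<Sum>i=1..k. \<beta> i * \<phi> (dot d (w i) x + b i)) + dot d (w 0) x + b 0)"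
  define S where "S = {(\<beta> :: nat \<Rightarrow> real, w :: nat \<Rightarrow> nat \<Rightarrow> real, b :: nat \<Rightarrow> real).
    (\<forall>i\<in>{1..k}. norm_one d (w i) \<le> a1 \<and> \<bar>b i\<bar> \<le> a1 \<and> \<bar>\<beta> i\<bar> \<le> a2) \<and>
        \<bar>b 0\<bar> \<le> a3 \<and> norm_one d (w 0) \<le> a4}"
  have class_eq: "network_class d k a1 a2 a3 a4 \<phi> = net ` S"
    unfolding network_class_def net_def S_def by (auto simp: image_def)
  obtain C where C: "countable C" "C \<subseteq> S" "S \<subseteq> closure C" using separable[of S] by blast
  have lim: "(\<lambda>m. net (p m) x) \<longlonglongrightarrow> net q x" if p: "p \<longlonglongrightarrow> q" for p q x
  proof -
    obtain \<beta> w b where q: "q = (\<beta>, w, b)" by (cases q)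
    have f: "(\<lambda>m. fst (p m)) \<longlonglongrightarrow> \<beta>" "(\<lambda>m. fst (snd (p m))) \<longlonglongrightarrow> w" "(\<lambda>m. snd (snd (p m))) \<longlonglongrightarrow> b"
      using tendsto_fst[OF p] tendsto_fst[OF tendsto_snd[OF p]] tendsto_snd[OF tendsto_snd[OF p]]
      by (simp_all add: q)
    have w: "(\<lambda>m. fst (snd (p m)) i j) \<longlonglongrightarrow> w i j" for i j
      by (rule tendsto_coordinate[OF tendsto_coordinate[OF f(2)]])
    have \<beta>b: "(\<lambda>m. fst (p m) i) \<longlonglongrightarrow> \<beta> i" "(\<lambda>m. snd (snd (p m)) i) \<longlonglongrightarrow> b i" for i
      by (rule tendsto_coordinate[OF f(1)], rule tendsto_coordinate[OF f(3)])
    have d: "(\<lambda>m. dot d (fst (snd (p m)) i) x) \<longlonglongrightarrow> dot d (w i) x" for i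
      unfolding dot_def by (intro tendsto_sum tendsto_mult tendsto_const w)
    have "(\<lambda>m. \<phi> (dot d (fst (snd (p m)) i) x + snd (snd (p m)) i)) \<longlonglongrightarrow> \<phi> (dot d (w i) x + b i)" for i
      by (rule continuous_on_tendsto_compose[OF \<phi> tendsto_add[OF d \<beta>b(2)]]) auto
    then have "(\<lambda>m. (\<Sum>i=1..k. fst (p m) i * \<phi> (dot d (fst (snd (p m)) i) x + snd (snd (p m)) i))
        + dot d (fst (snd (p m)) 0) x + snd (snd (p m)) 0) \<longlonglongrightarrow>
      (\<Sum>i=1..k. \<beta> i * \<phi> (dot d (w i) x + b i)) + dot d (w 0) x + b 0"
      by (intro tendsto_add tendsto_sum tendsto_mult \<beta>b d)
    then show ?thesis by (simp add: net_def q case_prod_beta)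
  qed
  show ?thesis
  proof (intro exI[of _ "net ` C"] conjI ballI)
    show "countable (net ` C)" using C by simp
    show "net ` C \<subseteq> network_class d k a1 a2 a3 a4 \<phi>" using C class_eq by auto
    fix g assume "g \<in> network_class d k a1 a2 a3 a4 \<phi>"
    then obtain q where q: "q \<in> S" "g = net q" using class_eq by auto
    then obtain p where p: "\<And>m. p m \<in> C" "p \<longlonglongrightarrow> q"
      using C(3) closure_sequential[of q C] by blast
    then show "\<exists>s. (\<forall>m. s m \<in> net ` C) \<and> (\<forall>x. (\<lambda>m. s m x) \<longlonglongrightarrow> g x)"
      using lim[OF p(2)] by (intro exI[of _ "\<lambda>m. net (p m)"]) (auto simp: q(2))
  qed
qed

lemma continuous_sigmoid: "continuous_on UNIV sigmoid"
proof -
  have "1 + exp (- z) \<noteq> 0" for z :: real using exp_gt_zero[of "- z"] by linarith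
  then show ?thesis unfolding sigmoid_def[abs_def] by (intro continuous_intros) auto
qed

lemma continuous_relu: "continuous_on UNIV relu"
  unfolding relu_def[abs_def] by (intro continuous_intros)

lemma convex_if_star_shaped_real:
  fixes J :: "real set"
  assumes star: "\<And>s l. s \<in> J \<Longrightarrow> 0 \<le> l \<Longrightarrow> l \<le> 1 \<Longrightarrow> l * s \<in> J"
  shows "convex J"
proof -
  have mem: "z \<in> J" if s: "s \<in> J" and t: "t \<in> J" and z: "s \<le> z" "z \<le> t" for s t z
  proof (cases "0 \<le> z")
    case True
    show ?thesis
    proof (cases "t = 0")
      case True
      then show ?thesis using t z \<open>0 \<le> z\<close> by simp
    next
      case False
      then have "z / t * t \<in> J" using z t True by (intro star) (auto simp: divide_le_eq_1)
      then show ?thesis using False by simp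
    qed
  next
    case False
    then have "z / s * s \<in> J" using z s by (intro star) (auto simp: divide_le_eq_1 divide_nonpos_nonpos)
    then show ?thesis using False z by simp
  qed
  show ?thesis unfolding is_interval_convex_1[symmetric] is_interval_1 using mem by blast
qed

section \<open>The expected error\<close>

lemma (in prob_space) abs_expectation_le:
  fixes f :: "'a \<Rightarrow> real"
  assumes "integrable M f" "\<And>x. x \<in> space M \<Longrightarrow> \<bar>f x\<bar> \<le> K"
  shows "\<bar>expectation f\<bar> \<le> K"
proof -
  have "\<bar>expectation f\<bar> \<le> expectation (\<lambda>x. \<bar>f x\<bar>)" by (rule integral_abs_bound)
  also have "\<dots> \<le> K" using assms by (intro integral_le_const integrable_abs AE_I2)
  finally show ?thesis .
qed

text \<open>
  Reduction of the theorem to Rademacher averages: \<open>r\<close> is the real-valued version of \<open>h\<close> on the values of the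
  class, and \<open>R\<close> bounds the Rademacher averages of \<open>G\<close> on arbitrary sample points. The two samples
  contribute \<open>4 R / n\<close> (contraction constant \<open>1\<close> for \<open>g\<close>) and \<open>4 K R / n\<close> (contraction constant \<open>K\<close> for
  \<open>h \<circ> g\<close>).
\<close>

lemma expected_error_le:
  fixes h :: "real \<Rightarrow> ereal" and r :: "real \<Rightarrow> real" and G :: "('a \<Rightarrow> real) set"
  assumes \<mu>: "prob_space \<mu>" "space \<mu> = X" and \<nu>: "prob_space \<nu>" "space \<nu> = X"
    and meas: "\<And>g. g \<in> G \<Longrightarrow> g \<in> borel_measurable \<mu>" "\<And>g. g \<in> G \<Longrightarrow> g \<in> borel_measurable \<nu>"
    and bound: "\<And>g x. g \<in> G \<Longrightarrow> x \<in> X \<Longrightarrow> \<bar>g x\<bar> \<le> K"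
    and h: "\<And>g x. g \<in> G \<Longrightarrow> x \<in> X \<Longrightarrow> h (g x) = ereal (r (g x))"
    and bound_r: "\<And>g x. g \<in> G \<Longrightarrow> x \<in> X \<Longrightarrow> \<bar>r (g x)\<bar> \<le> K"
    and lipschitz: "\<And>f g x y. f \<in> G \<Longrightarrow> g \<in> G \<Longrightarrow> x \<in> X \<Longrightarrow> y \<in> X \<Longrightarrow>
      \<bar>r (f x) - r (g y)\<bar> \<le> K * \<bar>f x - g y\<bar>"
    and zero: "(\<lambda>_. 0) \<in> G"
    and dense: "countable T" "T \<subseteq> G"
      "\<And>g. g \<in> G \<Longrightarrow> \<exists>s. (\<forall>m. s m \<in> T) \<and> (\<forall>x. (\<lambda>m. s m x) \<longlonglongrightarrow> g x)"
    and n: "n \<ge> 1"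
    and R: "\<And>F x. finite F \<Longrightarrow> F \<noteq> {} \<Longrightarrow> F \<subseteq> G \<Longrightarrow> x \<in> {..<n} \<rightarrow> X \<Longrightarrow>
      rademacher_mean n (\<lambda>\<sigma>. Max ((\<lambda>g. \<bar>\<Sum>i<n. \<sigma> i * g (x i)\<bar>) ` F)) \<le> R"
  shows "expected_error h G n \<mu> \<nu> \<le> ennreal (4 * (1 + K) * R / n)"
proof -
  interpret \<mu>: prob_space \<mu> by fact
  interpret \<nu>: prob_space \<nu> by fact
  obtain x0 where x0: "x0 \<in> X" using \<mu>.not_empty \<mu>(2) by auto
  have K: "0 \<le> K" using bound[OF zero x0] by simp
  define T0 where "T0 = insert (\<lambda>_. 0) T"
  have T0: "countable T0" "T0 \<subseteq> G" "(\<lambda>_. 0) \<in> T0" "T0 \<noteq> {}"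
    using dense zero by (auto simp: T0_def)
  have G0: "g \<in> G" if "g \<in> T0" for g using that T0 by blast
  \<comment> \<open>Outside the set \<open>J\<close> of values of the class nothing is known about \<open>r\<close>, so measurability of \<open>r \<circ> g\<close> comes from continuity on \<open>J\<close> alone.\<close>
  define J where "J = {g x | g x. g \<in> G \<and> x \<in> X}"
  have J_mem: "g x \<in> J" if "g \<in> G" "x \<in> X" for g x using that unfolding J_def by blast
  have contJ: "continuous_on J r"
  proof (rule continuous_onI)
    fix s e :: real assume s: "s \<in> J" and e: "0 < e"
    have "dist (r t) (r s) \<le> e" if "t \<in> J" "dist t s < e / (K + 1)" for t
    proof -
      have "\<bar>r t - r s\<bar> \<le> K * \<bar>t - s\<bar>" using lipschitz s that(1) by (auto simp: J_def)
      also have "\<dots> \<le> (K + 1) * \<bar>t - s\<bar>" by (simp add: mult_right_mono)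
      also have "\<dots> \<le> (K + 1) * (e / (K + 1))"
        using that(2) K by (intro mult_left_mono) (auto simp: dist_real_def)
      finally show ?thesis using K by (simp add: dist_real_def)
    qed
    then show "\<exists>d>0. \<forall>t\<in>J. dist t s < d \<longrightarrow> dist (r t) (r s) \<le> e"
      using e K by (intro exI[of _ "e / (K + 1)"]) auto
  qed
  have meas_r: "(\<lambda>x. r (g x)) \<in> borel_measurable \<nu>" if g: "g \<in> G" for g
  proof (rule measurable_compose[OF measurable_restrict_space2 borel_measurable_continuous_on_restrict[OF contJ]])
    show "g \<in> space \<nu> \<rightarrow> J" using g \<nu>(2) by (auto simp: J_def)
  qed (rule meas(2)[OF g])
  have int: "integrable \<mu> g" "integrable \<nu> (\<lambda>x. r (g x))" if g: "g \<in> G" for g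
    using g meas meas_r bound bound_r \<mu>(2) \<nu>(2)
    by (auto intro!: \<mu>.integrable_const_bound[of _ K] \<nu>.integrable_const_bound[of _ K])
  let ?P = "\<Pi>\<^sub>M i\<in>{..<n}. \<mu>" and ?Q = "\<Pi>\<^sub>M i\<in>{..<n}. \<nu>"
  let ?D1 = "\<lambda>g x. \<bar>\<Sum>i<n. g (x i) - \<mu>.expectation g\<bar>"
  let ?D2 = "\<lambda>g y. \<bar>\<Sum>i<n. r (g (y i)) - \<nu>.expectation (\<lambda>x. r (g x))\<bar>"
  define U1 where "U1 = (\<lambda>x. SUP g\<in>T0. ennreal (?D1 g x))"
  define U2 where "U2 = (\<lambda>y. SUP g\<in>T0. ennreal (?D2 g y))"
  have U1: "(\<integral>\<^sup>+x. U1 x \<partial>?P) \<le> ennreal (4 * 1 * R)"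
    unfolding U1_def
    by (rule \<mu>.countable_class_deviation[of T0 "\<lambda>_. 0" 1 "\<lambda>g. g" "\<lambda>g. g" K 0])
      (use T0 G0 meas bound R \<mu>(2) in auto)
  have U2: "(\<integral>\<^sup>+y. U2 y \<partial>?Q) \<le> ennreal (4 * K * R)"
    unfolding U2_def
    by (rule \<nu>.countable_class_deviation[of T0 "\<lambda>_. 0" K "\<lambda>g. g" "\<lambda>g x. r (g x)" K "r 0"])
      (use T0 G0 meas meas_r bound bound_r lipschitz R K \<nu>(2) in auto)
  have component: "(\<lambda>x. f (x i)) \<in> borel_measurable (\<Pi>\<^sub>M i\<in>{..<n}. N)"
    if "f \<in> borel_measurable N" "i < n" for f :: "'a \<Rightarrow> real" and N i
    by (rule measurable_compose[OF _ that(1)]) (rule measurable_component_singleton, use that in simp)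
  have measU: "U1 \<in> borel_measurable ?P" "U2 \<in> borel_measurable ?Q"
    unfolding U1_def U2_def
    by (intro borel_measurable_SUP T0 measurable_compose[OF _ measurable_ennreal] borel_measurable_abs
        borel_measurable_sum borel_measurable_diff borel_measurable_const component meas meas_r G0; simp)+
  define A where "A = (\<lambda>(\<omega> :: (nat \<Rightarrow> 'a) \<times> (nat \<Rightarrow> 'a)) g. (1 / n) * (\<Sum>i<n. g (fst \<omega> i) - r (g (snd \<omega> i))))"
  define E where "E = (\<lambda>g. \<mu>.expectation g - \<nu>.expectation (\<lambda>x. r (g x)))"
  have D: "D_dist h G \<mu> \<nu> = (SUP g\<in>G. ereal (E g))"
    unfolding D_dist_def
  proof (intro SUP_cong refl)
    fix g assume g: "g \<in> G"
    have "ext_expectation \<nu> (\<lambda>y. h (g y)) = ext_expectation \<nu> (\<lambda>y. ereal (r (g y)))"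
      unfolding ext_expectation_def
      by (intro arg_cong2[where f = "(-)"] arg_cong[where f = enn2ereal] nn_integral_cong)
        (simp_all add: h[OF g] \<nu>(2))
    then show "ext_expectation \<mu> (\<lambda>x. ereal (g x)) - ext_expectation \<nu> (\<lambda>y. h (g y)) = ereal (E g)"
      using int[OF g] by (simp add: ext_expectation_real E_def)
  qed
  have pointwise: "e2ennreal \<bar>D_emp h G n (fst \<omega>) (snd \<omega>) - D_dist h G \<mu> \<nu>\<bar>
      \<le> ennreal (1 / n) * (U1 (fst \<omega>) + U2 (snd \<omega>))" if \<omega>: "\<omega> \<in> space (?P \<Otimes>\<^sub>M ?Q)" for \<omega>
  proof -
    have X: "fst \<omega> i \<in> X" "snd \<omega> i \<in> X" if "i < n" for i
      using \<omega> that \<mu>(2) \<nu>(2) by (auto simp: space_pair_measure space_PiM PiE_iff)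
    have "D_emp h G n (fst \<omega>) (snd \<omega>) = (SUP g\<in>G. ereal (A \<omega> g))"
      unfolding D_emp_def
    proof (intro SUP_cong refl)
      fix g assume g: "g \<in> G"
      have "(\<Sum>i<n. ereal (g (fst \<omega> i)) - h (g (snd \<omega> i))) = (\<Sum>i<n. ereal (g (fst \<omega> i) - r (g (snd \<omega> i))))"
        using X h[OF g] by (intro sum.cong) auto
      then show "ereal (1 / real n) * (\<Sum>i<n. ereal (g (fst \<omega> i)) - h (g (snd \<omega> i))) = ereal (A \<omega> g)"
        by (simp add: A_def)
    qed
    then have "e2ennreal \<bar>D_emp h G n (fst \<omega>) (snd \<omega>) - D_dist h G \<mu> \<nu>\<bar>
        = e2ennreal \<bar>(SUP g\<in>G. ereal (A \<omega> g)) - (SUP g\<in>G. ereal (E g))\<bar>"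
      by (simp only: D)
    also have "\<dots> \<le> (SUP g\<in>T0. ennreal \<bar>A \<omega> g - E g\<bar>)"
    proof (rule abs_SUP_diff_le_SUP_dense[OF T0(2) T0(4), where c = "2 * K"])
      fix g assume g: "g \<in> G"
      have "\<bar>\<Sum>i<n. g (fst \<omega> i) - r (g (snd \<omega> i))\<bar> \<le> (\<Sum>i<n. \<bar>g (fst \<omega> i) - r (g (snd \<omega> i))\<bar>)"
        by (rule sum_abs)
      also have "\<dots> \<le> (\<Sum>i<n. 2 * K)"
      proof (rule sum_mono)
        fix i assume "i \<in> {..<n}"
        then show "\<bar>g (fst \<omega> i) - r (g (snd \<omega> i))\<bar> \<le> 2 * K"
          using bound[OF g X(1), of i] bound_r[OF g X(2), of i] by simp
      qed
      finally show "\<bar>A \<omega> g\<bar> \<le> 2 * K" using n by (simp add: A_def abs_mult field_simps)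
      have "\<bar>\<mu>.expectation g\<bar> \<le> K"
        using \<mu>.abs_expectation_le[OF int(1)[OF g]] bound[OF g] \<mu>(2) by simp
      moreover have "\<bar>\<nu>.expectation (\<lambda>x. r (g x))\<bar> \<le> K"
        using \<nu>.abs_expectation_le[OF int(2)[OF g]] bound_r[OF g] \<nu>(2) by simp
      ultimately show "\<bar>E g\<bar> \<le> 2 * K" by (simp add: E_def)
      obtain s where s: "\<And>m. s m \<in> T" "\<And>x. (\<lambda>m. s m x) \<longlonglongrightarrow> g x" using dense(3)[OF g] by blast
      have sG: "s m \<in> G" for m using s(1) dense(2) by blast
      have lim_r: "(\<lambda>m. r (s m x)) \<longlonglongrightarrow> r (g x)" if x: "x \<in> X" for x
        by (rule continuous_on_tendsto_compose[OF contJ s(2)])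
          (auto intro!: always_eventually J_mem g sG x)
      have "(\<lambda>m. A \<omega> (s m)) \<longlonglongrightarrow> A \<omega> g"
        unfolding A_def
        by (intro tendsto_mult tendsto_const tendsto_sum tendsto_diff s(2) lim_r X) simp
      moreover have "(\<lambda>m. \<mu>.expectation (s m)) \<longlonglongrightarrow> \<mu>.expectation g"
        by (rule integral_dominated_convergence[where w = "\<lambda>_. K"])
          (use meas g sG s(2) bound \<mu>(2) in auto)
      moreover have "(\<lambda>m. \<nu>.expectation (\<lambda>x. r (s m x))) \<longlonglongrightarrow> \<nu>.expectation (\<lambda>x. r (g x))"
        by (rule integral_dominated_convergence[where w = "\<lambda>_. K"])
          (use meas_r g sG lim_r bound_r \<nu>(2) in auto)
      ultimately show "\<exists>s. (\<forall>m. s m \<in> T0) \<and> (\<lambda>m. A \<omega> (s m)) \<longlonglongrightarrow> A \<omega> g \<and> (\<lambda>m. E (s m)) \<longlonglongrightarrow> E g"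
        using s(1) unfolding E_def by (intro exI[of _ s]) (auto simp: T0_def intro!: tendsto_diff)
    qed
    also have "\<dots> \<le> ennreal (1 / n) * (U1 (fst \<omega>) + U2 (snd \<omega>))"
    proof (rule SUP_least)
      fix g assume g: "g \<in> T0"
      have "A \<omega> g - E g = (1 / n) * ((\<Sum>i<n. g (fst \<omega> i) - \<mu>.expectation g)
          - (\<Sum>i<n. r (g (snd \<omega> i)) - \<nu>.expectation (\<lambda>x. r (g x))))"
        using n by (simp add: A_def E_def sum_subtractf field_simps)
      then have "\<bar>A \<omega> g - E g\<bar> \<le> (1 / n) * (?D1 g (fst \<omega>) + ?D2 g (snd \<omega>))"
        by (simp only: abs_mult) (intro mult_mono abs_triangle_ineq4, auto)
      then have "ennreal \<bar>A \<omega> g - E g\<bar> \<le> ennreal ((1 / n) * (?D1 g (fst \<omega>) + ?D2 g (snd \<omega>)))"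
        by (rule ennreal_leI)
      also have "\<dots> = ennreal (1 / n) * (ennreal (?D1 g (fst \<omega>)) + ennreal (?D2 g (snd \<omega>)))"
        by (subst ennreal_mult) simp_all
      also have "\<dots> \<le> ennreal (1 / n) * (U1 (fst \<omega>) + U2 (snd \<omega>))"
        unfolding U1_def U2_def by (intro mult_left_mono add_mono SUP_upper g) auto
      finally show "ennreal \<bar>A \<omega> g - E g\<bar> \<le> ennreal (1 / n) * (U1 (fst \<omega>) + U2 (snd \<omega>))" .
    qed
    finally show ?thesis .
  qed
  have R0: "0 \<le> R"
  proof -
    have "rademacher_mean n (\<lambda>\<sigma>. 0) \<le> R"
      using R[of "{\<lambda>_. 0}" "\<lambda>_. x0"] zero x0 by simp
    then show ?thesis by (simp add: rademacher_mean_const)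
  qed
  note [measurable] = measU
  have "expected_error h G n \<mu> \<nu> \<le> (\<integral>\<^sup>+\<omega>. ennreal (1 / n) * (U1 (fst \<omega>) + U2 (snd \<omega>)) \<partial>(?P \<Otimes>\<^sub>M ?Q))"
    unfolding expected_error_def sample_law_def using pointwise by (intro nn_integral_mono)
  also have "\<dots> = ennreal (1 / n) * (\<integral>\<^sup>+\<omega>. U1 (fst \<omega>) + U2 (snd \<omega>) \<partial>(?P \<Otimes>\<^sub>M ?Q))"
    by (rule nn_integral_cmult) measurable
  also have "\<dots> = ennreal (1 / n) * ((\<integral>\<^sup>+x. U1 x \<partial>?P) + (\<integral>\<^sup>+y. U2 y \<partial>?Q))"
    by (subst nn_integral_pair_add) (auto intro!: prob_space_PiM \<mu> \<nu> measU)
  also have "\<dots> \<le> ennreal (1 / n) * (ennreal (4 * 1 * R) + ennreal (4 * K * R))"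
    by (intro mult_left_mono add_mono U1 U2) auto
  also have "\<dots> = ennreal (1 / n * (4 * 1 * R + 4 * K * R))"
    using R0 K by (simp add: ennreal_plus[symmetric] ennreal_mult[symmetric] del: ennreal_plus)
  also have "1 / n * (4 * 1 * R + 4 * K * R) = 4 * (1 + K) * R / n"
    using n by (simp add: field_simps)
  finally show ?thesis .
qed

lemma upper_C_abs_boundD:
  assumes "upper_C (abs_funs (comp_class q G)) X \<le> ereal K" "g \<in> G" "x \<in> X"
  shows "\<bar>q (g x)\<bar> \<le> ereal K"
proof -
  have "\<bar>q (g x)\<bar> \<le> upper_C (abs_funs (comp_class q G)) X"
    unfolding upper_C_def abs_funs_def comp_class_def using assms(2,3)
    by (auto intro!: SUP_upper2[of "\<lambda>x. \<bar>q (g x)\<bar>"] SUP_upper2[of x])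
  then show ?thesis using assms(1) by (rule order_trans)
qed

lemma value_in_range_interval:
  assumes "g \<in> G" "x \<in> X"
  shows "g x \<in> range_interval G X"
  unfolding range_interval_def lower_C_def upper_C_def comp_class_def using assms
  by (auto intro!: SUP_upper2[of "\<lambda>x. ereal (g x)"] SUP_upper2[of x]
      INF_lower2[of "\<lambda>x. ereal (g x)"] INF_lower2[of x])

text \<open>
  The regularity arguments do not distinguish the two activations; only the Rademacher bounds do.
\<close>

lemma relu_or_sigmoid_class:
  assumes "G = relu_class d k a \<or> G = sigmoid_class d k a" "0 < a" "k \<ge> 1"
  obtains a1 a2 a3 a4 \<phi> where "G = network_class d k a1 a2 a3 a4 \<phi>" "continuous_on UNIV \<phi>"
    "0 \<le> a1" "0 \<le> a2" "0 \<le> a3" "0 \<le> a4"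
proof -
  consider "G = network_class d k 1 (2 * a / k) a a relu"
    | "G = network_class d k (sqrt k * ln k) (2 * a / k) a 0 sigmoid"
    using assms(1) by (auto simp: relu_class_def sigmoid_class_def)
  then show ?thesis
  proof cases
    case 1
    then show ?thesis using assms by (intro that[OF 1 continuous_relu]) auto
  next
    case 2
    then show ?thesis using assms by (intro that[OF 2 continuous_sigmoid]) auto
  qed
qed

theorem theorem12:
  fixes K :: "real \<Rightarrow> (real \<Rightarrow> ereal) \<Rightarrow> real \<Rightarrow> real"
  shows "\<exists>C :: (real \<Rightarrow> ereal) \<Rightarrow> real \<Rightarrow> real \<Rightarrow> real.
    \<forall>(d :: nat) (X :: vector set) (a :: real) (h :: real \<Rightarrow> ereal) (h' :: real \<Rightarrow> real)
      (G :: nat \<Rightarrow> (vector \<Rightarrow> real) set).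
      1 \<le> d \<longrightarrow>
      X \<subseteq> space (Rd d) \<longrightarrow>
      set_norm d X < \<infinity> \<longrightarrow>
      0 < a \<longrightarrow>
      (G = (\<lambda>k. relu_class d k a) \<or> G = (\<lambda>k. sigmoid_class d k a)) \<longrightarrow>
      (\<forall>k\<ge>1. has_derivative_fun_on h h' (range_interval (G k) X)) \<longrightarrow>
      (\<forall>k\<ge>1.
        max (upper_C (abs_funs (comp_class (\<lambda>t. ereal (h' t)) (G k))) X)
          (max (upper_C (abs_funs (comp_class h (G k))) X)
            (upper_C (abs_funs (comp_class ereal (G k))) X))
        \<le> ereal (K a h (enn2real (set_norm d X)))) \<longrightarrow>
      (\<forall>k\<ge>1. \<forall>n\<ge>1.
        (SUP \<mu>\<in>borel_probs d X. SUP \<nu>\<in>borel_probs d X. expected_error h (G k) n \<mu> \<nu>)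
        \<le> ennreal (C h a (enn2real (set_norm d X)) * real d powr (3/2) * real n powr (-1/2)))"
proof (intro exI[of _ "\<lambda>h a M. 4 * (1 + \<bar>K a h M\<bar>) * (a * (5 * M + 3)) * 348"] allI impI)
  fix d X and a :: real and h h' and G :: "nat \<Rightarrow> (vector \<Rightarrow> real) set" and k n :: nat
  assume d: "1 \<le> d" and X: "X \<subseteq> space (Rd d)" and fin: "set_norm d X < \<infinity>" and a: "0 < a"
    and G: "G = (\<lambda>k. relu_class d k a) \<or> G = (\<lambda>k. sigmoid_class d k a)"
    and deriv: "\<forall>k\<ge>1. has_derivative_fun_on h h' (range_interval (G k) X)"
    and bounded: "\<forall>k\<ge>1.
        max (upper_C (abs_funs (comp_class (\<lambda>t. ereal (h' t)) (G k))) X)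
          (max (upper_C (abs_funs (comp_class h (G k))) X)
            (upper_C (abs_funs (comp_class ereal (G k))) X))
        \<le> ereal (K a h (enn2real (set_norm d X)))"
    and k: "1 \<le> k" and n: "1 \<le> n"
  define M where "M = enn2real (set_norm d X)"
  define K0 where "K0 = K a h M"
  \<comment> \<open>The constant of the theorem is \<open>4 (1 + |K|) a (5M + 3) 348\<close>; the factor \<open>348 = 2 * 174\<close> absorbs \<open>d + 1 \<le> 2 d\<close>.\<close>
  define R where "R = a * (5 * M + 3) * (174 * (real d + 1) * sqrt n)"
  have M0: "0 \<le> M" by (simp add: M_def)
  have M: "\<bar>x j\<bar> \<le> M" if "x \<in> X" "j < d" for x j
  proof -
    have "ennreal \<bar>x j\<bar> \<le> set_norm d X"
      unfolding set_norm_def using that by (intro SUP_upper2[of x] SUP_upper2[of j]) auto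
    also have "\<dots> = ennreal M" using fin by (simp add: M_def)
    finally show ?thesis using M0 by simp
  qed
  obtain a1 a2 a3 a4 \<phi> where Gk: "G k = network_class d k a1 a2 a3 a4 \<phi>" and \<phi>: "continuous_on UNIV \<phi>"
    and pos: "0 \<le> a1" "0 \<le> a2" "0 \<le> a3" "0 \<le> a4"
    by (rule relu_or_sigmoid_class[of "G k" d k a]) (use G a k in auto)
  have zero: "(\<lambda>_. 0) \<in> G k" unfolding Gk using pos by (rule zero_in_network_class)
  obtain T where T: "countable T" "T \<subseteq> G k"
    "\<And>g. g \<in> G k \<Longrightarrow> \<exists>s. (\<forall>m. s m \<in> T) \<and> (\<forall>x. (\<lambda>m. s m x) \<longlonglongrightarrow> g x)"
    using network_class_countable_dense[OF \<phi>, of d k a1 a2 a3 a4] unfolding Gk by blast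
  have bounds: "\<bar>h' (g x)\<bar> \<le> K0" "\<bar>h (g x)\<bar> \<le> ereal K0" "\<bar>g x\<bar> \<le> K0" if "g \<in> G k" "x \<in> X" for g x
    using upper_C_abs_boundD[OF _ that, of "\<lambda>t. ereal (h' t)" K0] upper_C_abs_boundD[OF _ that, of h K0]
      upper_C_abs_boundD[OF _ that, of ereal K0] bounded k by (auto simp: K0_def M_def)
  define r where "r = (\<lambda>t. real_of_ereal (h t))"
  define J where "J = {g x | g x. g \<in> G k \<and> x \<in> X}"
  have J: "J \<subseteq> range_interval (G k) X" using value_in_range_interval by (auto simp: J_def)
  have h: "h (g x) = ereal (r (g x))" if "g \<in> G k" "x \<in> X" for g x
    using bounds(2)[OF that] by (cases "h (g x)") (auto simp: r_def)
  have convJ: "convex J"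
  proof (rule convex_if_star_shaped_real)
    fix s l :: real assume "s \<in> J" and l: "0 \<le> l" "l \<le> 1"
    then obtain g x where g: "g \<in> G k" "x \<in> X" "s = g x" by (auto simp: J_def)
    have "(\<lambda>x. l * g x) \<in> G k" using network_class_scale[of g d k a1 a2 a3 a4 \<phi>] g(1) l unfolding Gk by blast
    then show "l * s \<in> J"
      unfolding J_def mem_Collect_eq using g(2,3)
      by (intro exI[of _ "\<lambda>x. l * g x"] exI[of _ x]) simp
  qed
  have lipschitz: "\<bar>r s - r t\<bar> \<le> K0 * \<bar>s - t\<bar>" if "s \<in> J" "t \<in> J" for s t
  proof -
    have "norm (r s - r t) \<le> K0 * norm (s - t)"
    proof (rule field_differentiable_bound[OF convJ])
      fix z assume z: "z \<in> J"
      then have "(r has_field_derivative h' z) (at z within range_interval (G k) X)"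
        using deriv k J unfolding has_derivative_fun_on_def r_def by blast
      then show "(r has_field_derivative h' z) (at z within J)" using J by (rule DERIV_subset)
      show "norm (h' z) \<le> K0" using z bounds(1) by (auto simp: J_def)
    qed (use that in auto)
    then show ?thesis by simp
  qed
  have network_bound: "\<bar>\<Sum>i<n. \<sigma> i * g (x i)\<bar> \<le> a * (5 * M + 3) * halfspace_sup d n x \<sigma>"
    if g: "g \<in> G k" and x: "x \<in> {..<n} \<rightarrow> X" for g x \<sigma>
  proof -
    have xM: "\<bar>x i j\<bar> \<le> M" if "i < n" "j < d" for i j
      using x that by (intro M) auto
    from G show ?thesis
    proof
      assume "G = (\<lambda>k. relu_class d k a)"
      then show ?thesis using g a k M0 xM by (intro relu_class_bound) auto
    next
      assume "G = (\<lambda>k. sigmoid_class d k a)"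
      then show ?thesis using g a k M0 xM by (intro sigmoid_class_bound) auto
    qed
  qed
  have R: "rademacher_mean n (\<lambda>\<sigma>. Max ((\<lambda>g. \<bar>\<Sum>i<n. \<sigma> i * g (x i)\<bar>) ` F)) \<le> R"
    if F: "finite F" "F \<noteq> {}" "F \<subseteq> G k" and x: "x \<in> {..<n} \<rightarrow> X" for F x
  proof -
    have "rademacher_mean n (\<lambda>\<sigma>. Max ((\<lambda>g. \<bar>\<Sum>i<n. \<sigma> i * g (x i)\<bar>) ` F))
        \<le> rademacher_mean n (\<lambda>\<sigma>. a * (5 * M + 3) * halfspace_sup d n x \<sigma>)"
      using F network_bound[OF _ x] by (intro rademacher_mean_mono Max.boundedI) auto
    also have "\<dots> = a * (5 * M + 3) * rademacher_mean n (halfspace_sup d n x)"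
      by (rule rademacher_mean_cmult)
    also have "\<dots> \<le> R"
      unfolding R_def using rademacher_mean_halfspace_sup_le[OF n] a M0 by (intro mult_left_mono) auto
    finally show ?thesis .
  qed
  have rate: "4 * (1 + K0) * R / n
      \<le> 4 * (1 + \<bar>K0\<bar>) * (a * (5 * M + 3)) * 348 * real d powr (3/2) * real n powr (-1/2)"
  proof -
    have "real d + 1 \<le> 2 * real d" using d by simp
    also have "real d \<le> real d powr (3/2)" using powr_mono[of 1 "3/2" "real d"] d by simp
    finally have d': "174 * (real d + 1) \<le> 348 * real d powr (3/2)" by simp
    have n': "sqrt n / n = real n powr (-1/2)"
      using n by (simp add: powr_minus powr_half_sqrt divide_inverse[symmetric] real_div_sqrt field_simps)
    have "4 * (1 + K0) * R / n = 4 * (1 + K0) * ((a * (5 * M + 3)) * ((174 * (real d + 1)) * (sqrt n / n)))"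
      by (simp add: R_def)
    also have "\<dots> \<le> 4 * (1 + \<bar>K0\<bar>) * ((a * (5 * M + 3)) * ((348 * real d powr (3/2)) * (sqrt n / n)))"
    proof (rule mult_mono)
      show "(a * (5 * M + 3)) * ((174 * (real d + 1)) * (sqrt n / n))
          \<le> (a * (5 * M + 3)) * ((348 * real d powr (3/2)) * (sqrt n / n))"
        using a M0 d' by (intro mult_left_mono[OF mult_right_mono]) auto
    qed (use a M0 in auto)
    finally show ?thesis by (simp only: n' mult.assoc)
  qed
  show "(SUP \<mu>\<in>borel_probs d X. SUP \<nu>\<in>borel_probs d X. expected_error h (G k) n \<mu> \<nu>)
      \<le> ennreal (4 * (1 + \<bar>K a h (enn2real (set_norm d X))\<bar>) * (a * (5 * enn2real (set_norm d X) + 3)) * 348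
          * real d powr (3/2) * real n powr (-1/2))"
  proof (intro SUP_least)
    fix \<mu> \<nu> assume "\<mu> \<in> borel_probs d X" "\<nu> \<in> borel_probs d X"
    then have \<mu>: "prob_space \<mu>" "sets \<mu> = sets (restrict_space (Rd d) X)"
      and \<nu>: "prob_space \<nu>" "sets \<nu> = sets (restrict_space (Rd d) X)"
      by (auto simp: borel_probs_def)
    have space: "space N = X" if "sets N = sets (restrict_space (Rd d) X)" for N
      using sets_eq_imp_space_eq[OF that] X by (auto simp: space_restrict_space)
    have "\<phi> \<in> borel_measurable borel" using \<phi> by (rule borel_measurable_continuous_onI)
    then have meas: "g \<in> borel_measurable N" if "g \<in> G k" "sets N = sets (restrict_space (Rd d) X)" for g N
      using network_class_measurable[of g d k a1 a2 a3 a4 \<phi>] that Gk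
      by (subst measurable_cong_sets[OF that(2) refl]) (auto intro: measurable_restrict_space1)
    have "expected_error h (G k) n \<mu> \<nu> \<le> ennreal (4 * (1 + K0) * R / n)"
    proof (rule expected_error_le[where X = X and r = r and T = T])
      fix f g x y assume fg: "f \<in> G k" "g \<in> G k" "x \<in> X" "y \<in> X"
      then show "\<bar>r (f x) - r (g y)\<bar> \<le> K0 * \<bar>f x - g y\<bar>" by (intro lipschitz) (auto simp: J_def)
    next
      fix g x assume "g \<in> G k" "x \<in> X"
      then show "\<bar>r (g x)\<bar> \<le> K0" using bounds(2)[of g x] h[of g x] by simp
    next
      fix F x
      assume "finite F" "F \<noteq> {}" "F \<subseteq> G k" "x \<in> {..<n} \<rightarrow> X"
      then show "rademacher_mean n (\<lambda>\<sigma>. Max ((\<lambda>g. \<bar>\<Sum>i<n. \<sigma> i * g (x i)\<bar>) ` F)) \<le> R" by (rule R)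
    qed (fact \<mu>(1) \<nu>(1) space[OF \<mu>(2)] space[OF \<nu>(2)] zero T(1) T(2) n
        | erule meas, fact \<mu>(2) \<nu>(2) | erule T(3) | erule (1) bounds(3) h)+
    also have "\<dots> \<le> ennreal (4 * (1 + \<bar>K0\<bar>) * (a * (5 * M + 3)) * 348 * real d powr (3/2) * real n powr (-1/2))"
      using rate by (rule ennreal_leI)
    finally show "expected_error h (G k) n \<mu> \<nu>
      \<le> ennreal (4 * (1 + \<bar>K a h (enn2real (set_norm d X))\<bar>) * (a * (5 * enn2real (set_norm d X) + 3)) * 348
          * real d powr (3/2) * real n powr (-1/2))"
      by (simp only: K0_def M_def)
  qed
qed

end
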